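(* Let $G$ be a finite connected graph. Then $G$ is $\mathcal{C}$-$\mathrm{HH}$ if and only if $G$ is one of the following: (i) $K_1$; (ii) a $K_n$-treelike graph for some $n \ge 2$; (iii) a graph in which every induced cycle is a square (an induced $4$-cycle) and in which the two-squares graph does not embed; (iv) a bipartite graph, with bipartition $(X,Y)$, such that each part has a common neighbour, i.e. there is a vertex adjacent to every vertex of $X$ and a vertex adjacent to every vertex of $Y$; (v) the bipartite complement of a perfect matching $\overline{L(K_{2,n})}$ for some $n \ge 3$.
   Context: Graphs are simple. "Subgraph" always means induced subgraph, and "$H$ embeds in $G$" means $H$ is isomorphic to an induced subgraph of $G$. A homomorphism of graphs is a map on vertices sending edges to edges; an endomorphism of $G$ is a homomorphism $G \to G$. A graph $G$ is $\mathcal{C}$-$\mathrm{HH}$ if every homomorphism from a finite connected induced subgraph of $G$ into $G$ extends to an endomorphism of $G$. For $n \ge 2$, a $K_n$-treelike graph is a finite connected graph $G$ whose vertex set is covered by a family of $n$-element vertex sets (components), each inducing a complete graph $K_n$, such that every edge of $G$ lies inside some component, two distinct components share at most one vertex, and every induced cycle of $G$ has all its vertices inside a single component (i.e. $G$ is built from copies of $K_n$ by identifying single vertices of distinct copies without creating new induced cycles). In particular $K_n$ itself is $K_n$-treelike, and the $K_2$-treelike graphs are exactly the finite trees. The two-squares graph is the $6$-cycle $v_1v_2v_3v_4v_5v_6v_1$ together with the single chord $v_3v_6$. The bipartite complement of a perfect matching $\overline{L(K_{2,n})}$ is the bipartite graph with parts $\{x_1,\dots,x_n\}$ and $\{y_1,\dots,y_n\}$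 in which $x_i \sim y_j$ if and only if $i \neq j$. *)

theory Defs
  imports Main
begin

definition sgraph :: "'a set \<Rightarrow> ('a \<Rightarrow> 'a \<Rightarrow> bool) \<Rightarrow> bool" where
  "sgraph V E \<equiv> (\<forall>x y. E x y \<longrightarrow> x \<in> V \<and> y \<in> V) \<and> (\<forall>x y. E x y \<longrightarrow> E y x) \<and> (\<forall>x. \<not> E x x)"

definition connected_on :: "('a \<Rightarrow> 'a \<Rightarrow> bool) \<Rightarrow> 'a set \<Rightarrow> bool" where
  "connected_on E S \<equiv> S \<noteq> {} \<and>
     (\<forall>x\<in>S. \<forall>y\<in>S. (\<lambda>a b. E a b \<and> a \<in> S \<and> b \<in> S)\<^sup>*\<^sup>* x y)"

definition ghom :: "'a set \<Rightarrow> ('a \<Rightarrow> 'a \<Rightarrow> bool) \<Rightarrow> 'b set \<Rightarrow> ('b \<Rightarrow> 'b \<Rightarrow> bool) \<Rightarrow> ('a \<Rightarrow> 'b) \<Rightarrow> bool" where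
  "ghom V E V' E' f \<equiv> (\<forall>x\<in>V. f x \<in> V') \<and> (\<forall>x\<in>V. \<forall>y\<in>V. E x y \<longrightarrow> E' (f x) (f y))"

definition C_HH :: "'a set \<Rightarrow> ('a \<Rightarrow> 'a \<Rightarrow> bool) \<Rightarrow> bool" where
  "C_HH V E \<equiv> \<forall>S f. S \<subseteq> V \<and> finite S \<and> connected_on E S \<and> ghom S E V E f \<longrightarrow>
      (\<exists>g. ghom V E V E g \<and> (\<forall>x\<in>S. g x = f x))"

definition embeds :: "'b set \<Rightarrow> ('b \<Rightarrow> 'b \<Rightarrow> bool) \<Rightarrow> 'a set \<Rightarrow> ('a \<Rightarrow> 'a \<Rightarrow> bool) \<Rightarrow> bool" where
  "embeds VH EH V E \<equiv> \<exists>f. inj_on f VH \<and> f ` VH \<subseteq> V \<and>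
      (\<forall>x\<in>VH. \<forall>y\<in>VH. EH x y \<longleftrightarrow> E (f x) (f y))"

definition isomorphic :: "'b set \<Rightarrow> ('b \<Rightarrow> 'b \<Rightarrow> bool) \<Rightarrow> 'a set \<Rightarrow> ('a \<Rightarrow> 'a \<Rightarrow> bool) \<Rightarrow> bool" where
  "isomorphic VH EH V E \<equiv> \<exists>f. bij_betw f VH V \<and>
      (\<forall>x\<in>VH. \<forall>y\<in>VH. EH x y \<longleftrightarrow> E (f x) (f y))"

definition induced_cycle :: "'a set \<Rightarrow> ('a \<Rightarrow> 'a \<Rightarrow> bool) \<Rightarrow> 'a list \<Rightarrow> bool" where
  "induced_cycle V E vs \<equiv> length vs \<ge> 3 \<and> distinct vs \<and> set vs \<subseteq> V \<and>
     (\<forall>i<length vs. \<forall>j<length vs. E (vs ! i) (vs ! j) \<longleftrightarrow>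
         (j = Suc i mod length vs \<or> i = Suc j mod length vs))"

definition Kn_treelike :: "nat \<Rightarrow> 'a set \<Rightarrow> ('a \<Rightarrow> 'a \<Rightarrow> bool) \<Rightarrow> bool" where
  "Kn_treelike n V E \<equiv> finite V \<and> connected_on E V \<and>
     (\<exists>\<C>. (\<forall>C\<in>\<C>. C \<subseteq> V \<and> card C = n \<and> (\<forall>x\<in>C. \<forall>y\<in>C. x \<noteq> y \<longrightarrow> E x y)) \<and>
          \<Union>\<C> = V \<and>
          (\<forall>x y. E x y \<longrightarrow> (\<exists>C\<in>\<C>. x \<in> C \<and> y \<in> C)) \<and>
          (\<forall>C\<in>\<C>. \<forall>D\<in>\<C>. C \<noteq> D \<longrightarrow> card (C \<inter> D) \<le> 1) \<and>
          (\<forall>vs. induced_cycle V E vs \<longrightarrow> (\<exists>C\<in>\<C>. set vs \<subseteq> C)))"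

definition two_squares_V :: "nat set" where "two_squares_V = {1..6}"
definition two_squares_E :: "nat \<Rightarrow> nat \<Rightarrow> bool" where
  "two_squares_E x y \<equiv> {x, y} \<in> {{1,2},{2,3},{3,4},{4,5},{5,6},{6,1},{3,6}}"

text \<open>Bipartite complement of a perfect matching: (False,i) = x_i, (True,j) = y_j.\<close>
definition bcpm_V :: "nat \<Rightarrow> (bool \<times> nat) set" where
  "bcpm_V n = UNIV \<times> {..<n}"
definition bcpm_E :: "nat \<Rightarrow> bool \<times> nat \<Rightarrow> bool \<times> nat \<Rightarrow> bool" where
  "bcpm_E n u v \<equiv> fst u \<noteq> fst v \<and> snd u \<noteq> snd v \<and> snd u < n \<and> snd v < n"

definition bip_common_nbrs :: "'a set \<Rightarrow> ('a \<Rightarrow> 'a \<Rightarrow> bool) \<Rightarrow> bool" where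
  "bip_common_nbrs V E \<equiv> \<exists>X Y. X \<inter> Y = {} \<and> X \<union> Y = V \<and>
      (\<forall>x y. E x y \<longrightarrow> (x \<in> X \<and> y \<in> Y) \<or> (x \<in> Y \<and> y \<in> X)) \<and>
      (\<exists>a\<in>V. \<forall>x\<in>X. E a x) \<and> (\<exists>b\<in>V. \<forall>y\<in>Y. E b y)"

end

theory Submission
  imports Defs
begin

text \<open>By finiteness, being C-HH amounts to one-point extension: for a connected S, a homomorphism f
  on S and a vertex v outside S, the image under f of the neighbourhood of v in S has a common
  neighbour. In each of the listed classes this is checked directly; in class (iii) the neighbours
  of v in S already have a common neighbour u in S, so v can be sent to f u.

  Conversely, let K be a largest clique. If K has at least three vertices, a vertex outside K has
  at most one neighbour in K, and a shortest induced cycle of length at least four could be folded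
  to contradict one-point extension, so the largest cliques are the components of a treelike graph.
  If there are no triangles, folding an odd induced cycle onto an edge excludes it, while an induced
  cycle of length at least six, or two squares sharing an edge, can be folded so as to give the ends
  of every 4-walk a common neighbour. Then G is bipartite and vertices in one part have pairwise
  common neighbours. If some part has no common neighbour, a minimal subset S of it without one
  yields, with vertices t x adjacent to all of S except x, a bipartite complement of a perfect
  matching, and no further vertex can be attached to it.\<close>

subsection \<open>One-point extension\<close>

text \<open>\<open>w\<close> is a possible value at \<open>v\<close>: in a simple graph the
  condition says exactly that \<open>f(v := w)\<close> is again a homomorphism on
  \<open>insert v S\<close>. When \<open>v\<close> has no neighbour in \<open>S\<close>, any vertex
  of \<open>V\<close> qualifies.\<close>

definition one_point_ext :: "'a set \<Rightarrow> ('a \<Rightarrow> 'a \<Rightarrow> bool) \<Rightarrow> bool" where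
  "one_point_ext V E \<longleftrightarrow> (\<forall>S f v. S \<subseteq> V \<longrightarrow> connected_on E S \<longrightarrow> ghom S E V E f \<longrightarrow> v \<in> V \<longrightarrow> v \<notin> S
     \<longrightarrow> (\<exists>w\<in>V. \<forall>u\<in>S. E u v \<longrightarrow> E (f u) w))"

lemma one_point_extD:
  assumes "one_point_ext V E" "S \<subseteq> V" "connected_on E S" "ghom S E V E f" "v \<in> V" "v \<notin> S"
  obtains w where "w \<in> V" "\<And>u. u \<in> S \<Longrightarrow> E u v \<Longrightarrow> E (f u) w"
  using assms unfolding one_point_ext_def by metis

lemma connected_on_induct:
  assumes "connected_on E S" "a \<in> S" "P a"
    and step: "\<And>x y. x \<in> S \<Longrightarrow> y \<in> S \<Longrightarrow> E x y \<Longrightarrow> P x \<Longrightarrow> P y"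
    and "x \<in> S"
  shows "P x"
proof -
  have "(\<lambda>a b. E a b \<and> a \<in> S \<and> b \<in> S)\<^sup>*\<^sup>* a x"
    using assms unfolding connected_on_def by blast
  then show ?thesis
    by (induction rule: rtranclp_induct) (use assms in auto)
qed

text \<open>Otherwise \<open>U\<close> would be closed under the edges inside \<open>S\<close>, and
  induction from a point of \<open>U\<close> would fill \<open>S\<close>.\<close>

lemma connected_on_boundary:
  assumes "connected_on E S" "U \<subseteq> S" "U \<noteq> {}" "U \<noteq> S"
  obtains u v where "u \<in> U" "v \<in> S" "v \<notin> U" "E u v"
proof -
  obtain a where a: "a \<in> U" using assms by blast
  have "\<exists>u v. u \<in> U \<and> v \<in> S \<and> v \<notin> U \<and> E u v"
  proof (rule ccontr)
    assume *: "\<not> ?thesis"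
    have "x \<in> U" if "x \<in> S" for x
      by (rule connected_on_induct[OF assms(1), of a "\<lambda>x. x \<in> U"]) (use a assms that * in auto)
    then show False using assms by blast
  qed
  then show ?thesis using that by blast
qed

text \<open>Symmetry lets every pair be joined through the root \<open>r\<close>. The closed sets
  \<open>U\<close> make it possible to prove connectedness by collecting vertices, without writing
  down walks.\<close>

lemma connected_onI:
  assumes sym: "\<And>x y. E x y \<Longrightarrow> E y x" and r: "r \<in> S"
    and closed: "\<And>U. r \<in> U \<Longrightarrow> (\<And>x y. x \<in> U \<Longrightarrow> x \<in> S \<Longrightarrow> y \<in> S \<Longrightarrow> E x y \<Longrightarrow> y \<in> U) \<Longrightarrow> S \<subseteq> U"
  shows "connected_on E S"
proof -
  let ?R = "\<lambda>a b. E a b \<and> a \<in> S \<and> b \<in> S"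
  have 1: "S \<subseteq> {x. ?R\<^sup>*\<^sup>* r x}"
    by (rule closed) (auto intro: rtranclp.rtrancl_into_rtrancl)
  have 2: "?R\<^sup>*\<^sup>* x r" if "?R\<^sup>*\<^sup>* r x" for x
    using that
    by (induction rule: rtranclp_induct) (auto intro: sym converse_rtranclp_into_rtranclp)
  show ?thesis
    unfolding connected_on_def using r 1 2 by (blast intro: rtranclp_trans)
qed

lemma third_element:
  assumes "3 \<le> card S"
  obtains t where "t \<in> S" "t \<noteq> x" "t \<noteq> y"
proof -
  have "\<not> S \<subseteq> {x, y}"
  proof
    assume "S \<subseteq> {x, y}"
    then have "card S \<le> card {x, y}" by (intro card_mono) auto
    also have "\<dots> \<le> 2" by (simp add: card_insert_if)
    finally show False using assms by simp
  qed
  then show ?thesis using that by blast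
qed

subsection \<open>Induced paths\<close>

text \<open>The equivalence forbids chords, so the list is an induced path. The empty list counts as
  a path, hence the hypotheses \<open>p \<noteq> []\<close> further on.\<close>

definition ipath :: "('a \<Rightarrow> 'a \<Rightarrow> bool) \<Rightarrow> 'a list \<Rightarrow> bool" where
  "ipath E p \<longleftrightarrow> distinct p \<and>
     (\<forall>i<length p. \<forall>j<length p. E (p ! i) (p ! j) \<longleftrightarrow> j = Suc i \<or> i = Suc j)"

lemma ipath_take: "ipath E p \<Longrightarrow> ipath E (take n p)"
  by (auto simp: ipath_def)

lemma ipath_drop:
  assumes "ipath E p" shows "ipath E (drop n p)"
  unfolding ipath_def
proof (intro conjI allI impI)
  show "distinct (drop n p)" using assms by (auto simp: ipath_def)
  fix i j assume "i < length (drop n p)" "j < length (drop n p)"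
  then show "E (drop n p ! i) (drop n p ! j) \<longleftrightarrow> j = Suc i \<or> i = Suc j"
    using assms by (auto simp: ipath_def)
qed

lemma ipath_nth_eq_iff: "ipath E p \<Longrightarrow> i < length p \<Longrightarrow> j < length p \<Longrightarrow> p ! i = p ! j \<longleftrightarrow> i = j"
  by (simp add: ipath_def nth_eq_iff_index_eq)

lemma ipath_edge_iff:
  "ipath E p \<Longrightarrow> i < length p \<Longrightarrow> j < length p \<Longrightarrow> E (p ! i) (p ! j) \<longleftrightarrow> j = Suc i \<or> i = Suc j"
  by (simp add: ipath_def)

lemma ipath_step: "ipath E p \<Longrightarrow> Suc i < length p \<Longrightarrow> E (p ! i) (p ! Suc i)"
  by (auto simp: ipath_def)

section \<open>Finite connected graphs: extending homomorphisms, induced cycles and paths\<close>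

locale finite_connected_graph =
  fixes V :: "'a set" and E :: "'a \<Rightarrow> 'a \<Rightarrow> bool"
  assumes sgraph: "sgraph V E" and finite: "finite V" and connected: "connected_on E V"
begin

lemma edge_in: "E x y \<Longrightarrow> x \<in> V" "E x y \<Longrightarrow> y \<in> V"
  using sgraph by (auto simp: sgraph_def)

lemma edge_sym: "E x y \<Longrightarrow> E y x"
  using sgraph by (auto simp: sgraph_def)

lemma edge_commute: "E x y \<longleftrightarrow> E y x"
  using edge_sym by blast

lemma edge_irrefl [simp]: "\<not> E x x"
  using sgraph by (auto simp: sgraph_def)

lemma V_nonempty: "V \<noteq> {}"
  using connected by (auto simp: connected_on_def)

lemma connected_on_insert:
  assumes "connected_on E S" "u \<in> S" "E u v"
  shows "connected_on E (insert v S)"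
proof (rule connected_onI)
  show "u \<in> insert v S" using assms by auto
  fix U assume U: "u \<in> U" "\<And>x y. x \<in> U \<Longrightarrow> x \<in> insert v S \<Longrightarrow> y \<in> insert v S \<Longrightarrow> E x y \<Longrightarrow> y \<in> U"
  have "x \<in> U" if "x \<in> S" for x
    by (rule connected_on_induct[OF assms(1), of u "\<lambda>x. x \<in> U"]) (use assms that U in auto)
  then show "insert v S \<subseteq> U" using U assms by blast
qed (rule edge_sym)

lemma connected_on_nbr:
  assumes "connected_on E S" "x \<in> S" "S \<noteq> {x}"
  obtains y where "y \<in> S" "E x y"
  using connected_on_boundary[OF assms(1), of "{x}"] assms by auto

text \<open>Forward, the value at \<open>v\<close> of an extension is the required vertex. Backward,
  a homomorphism on \<open>S\<close> is enlarged one vertex at a time, by induction on the number of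
  vertices outside \<open>S\<close>.\<close>

lemma C_HH_iff_one_point_ext: "C_HH V E \<longleftrightarrow> one_point_ext V E"
proof
  assume C: "C_HH V E"
  show "one_point_ext V E"
    unfolding one_point_ext_def
  proof (intro allI impI)
    fix S f v assume *: "S \<subseteq> V" "connected_on E S" "ghom S E V E f" "v \<in> V" "v \<notin> S"
    then obtain g where g: "ghom V E V E g" "\<And>x. x \<in> S \<Longrightarrow> g x = f x"
      using C finite_subset[OF _ finite] unfolding C_HH_def by metis
    then show "\<exists>w\<in>V. \<forall>u\<in>S. E u v \<longrightarrow> E (f u) w"
      using * by (intro bexI[of _ "g v"]) (auto simp: ghom_def, metis subsetD)
  qed
next
  assume ext: "one_point_ext V E"
  have "\<exists>g. ghom V E V E g \<and> (\<forall>x\<in>S. g x = f x)"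
    if "S \<subseteq> V" "connected_on E S" "ghom S E V E f" for S f
    using that
  proof (induction "card (V - S)" arbitrary: S f rule: less_induct)
    case less
    show ?case
    proof (cases "S = V")
      case True then show ?thesis using less by blast
    next
      case False
      moreover have "S \<noteq> {}" using less by (auto simp: connected_on_def)
      \<comment> \<open>Choosing \<open>v\<close> adjacent to \<open>S\<close> keeps
        \<open>insert v S\<close> connected, so that the induction hypothesis applies to it.\<close>
      ultimately obtain u v where uv: "u \<in> S" "v \<in> V" "v \<notin> S" "E u v"
        using connected_on_boundary[OF connected less(2)] by metis
      obtain w where w: "w \<in> V" "\<And>u. u \<in> S \<Longrightarrow> E u v \<Longrightarrow> E (f u) w"
        using one_point_extD[OF ext less(2,3,4) uv(2,3)] by metis
      have "card (V - insert v S) < card (V - S)"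
        using uv finite by (intro psubset_card_mono) auto
      moreover have "ghom (insert v S) E V E (f(v := w))"
        unfolding ghom_def
      proof (intro conjI ballI impI)
        show "(f(v := w)) x \<in> V" if "x \<in> insert v S" for x
          using that w less(4) by (auto simp: ghom_def)
        fix x y assume "x \<in> insert v S" "y \<in> insert v S" "E x y"
        then show "E ((f(v := w)) x) ((f(v := w)) y)"
          using less(4) w(2)[of x] w(2)[of y] uv(3) edge_commute[of v y] edge_commute[of w]
          by (cases "x = v"; cases "y = v") (auto simp: ghom_def)
      qed
      moreover have "connected_on E (insert v S)"
        using connected_on_insert less uv by blast
      moreover have "insert v S \<subseteq> V" using less(2) uv(2) by simp
      ultimately have "\<exists>g. ghom V E V E g \<and> (\<forall>x\<in>insert v S. g x = (f(v := w)) x)"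
        by (intro less(1))
      then obtain g where "ghom V E V E g" "\<forall>x\<in>insert v S. g x = (f(v := w)) x"
        by blast
      then show ?thesis using uv(3) by (intro exI[of _ g]) auto
    qed
  qed
  then show "C_HH V E" unfolding C_HH_def by blast
qed

text \<open>Removing the head \<open>v\<close> of a cycle leaves an induced path whose ends are the
  only neighbours of \<open>v\<close>. Most later arguments use this form, which is free of modular
  indices.\<close>

lemma induced_cycle_Cons:
  "induced_cycle V E (v # p) \<longleftrightarrow> v \<in> V \<and> set p \<subseteq> V \<and> 2 \<le> length p \<and> v \<notin> set p \<and> ipath E p \<and>
     (\<forall>i<length p. E v (p ! i) \<longleftrightarrow> i = 0 \<or> Suc i = length p)" (is "?L \<longleftrightarrow> ?R")
proof -
  \<comment> \<open>Only the last index \<open>n\<close> wraps around to 0.\<close>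
  have mod: "j = Suc i mod Suc n \<longleftrightarrow> (j = Suc i \<and> i \<noteq> n) \<or> (j = 0 \<and> i = n)" if "i \<le> n" "j \<le> n" for i j n :: nat
    using that by (cases "i = n") auto
  let ?n = "length p"
  have "(\<forall>i<Suc ?n. \<forall>j<Suc ?n. E ((v # p) ! i) ((v # p) ! j) \<longleftrightarrow>
         (j = Suc i mod Suc ?n \<or> i = Suc j mod Suc ?n)) \<longleftrightarrow>
      (\<forall>i<?n. E v (p ! i) \<longleftrightarrow> i = 0 \<or> Suc i = ?n) \<and>
      (\<forall>i<?n. \<forall>j<?n. E (p ! i) (p ! j) \<longleftrightarrow> j = Suc i \<or> i = Suc j)" if "?n \<ge> 2"
    unfolding All_less_Suc2 using that
    by (auto simp: mod less_Suc_eq_le edge_commute[of _ v])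
  then show ?thesis
    by (auto simp: induced_cycle_def ipath_def)
qed

lemma induced_cycle_cases:
  assumes "induced_cycle V E vs"
  obtains v p where "vs = v # p" "v \<in> V" "set p \<subseteq> V" "2 \<le> length p" "v \<notin> set p" "ipath E p"
    "\<And>i. i < length p \<Longrightarrow> E v (p ! i) \<longleftrightarrow> i = 0 \<or> Suc i = length p"
proof (cases vs)
  case Nil then show ?thesis using assms by (simp add: induced_cycle_def)
next
  case (Cons v p) then show ?thesis using assms that induced_cycle_Cons by blast
qed

lemma ipath_connected:
  assumes "ipath E p" "p \<noteq> []"
  shows "connected_on E (set p)"
proof (rule connected_onI)
  show "p ! 0 \<in> set p" using assms by auto
  fix U assume U: "p ! 0 \<in> U" "\<And>x y. x \<in> U \<Longrightarrow> x \<in> set p \<Longrightarrow> y \<in> set p \<Longrightarrow> E x y \<Longrightarrow> y \<in> U"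
  have "p ! i \<in> U" if "i < length p" for i
    using that
  proof (induction i)
    case (Suc i)
    then show ?case using U(2)[of "p ! i" "p ! Suc i"] ipath_step[OF assms(1), of i] by auto
  qed (use U in simp)
  then show "set p \<subseteq> U" by (auto simp: in_set_conv_nth)
qed (rule edge_sym)

text \<open>The path grows along a walk in \<open>S\<close> from \<open>a\<close>. When the walk
  moves on to \<open>y\<close>, the current path is cut at \<open>y\<close> if it already contains
  it, and otherwise at its first neighbour of \<open>y\<close>, after which \<open>y\<close> can be
  appended without creating a chord.\<close>

lemma ipath_exists:
  assumes "connected_on E S" "a \<in> S" "b \<in> S"
  obtains p where "ipath E p" "p \<noteq> []" "set p \<subseteq> S" "hd p = a" "last p = b"
proof -
  have "\<exists>p. ipath E p \<and> p \<noteq> [] \<and> set p \<subseteq> S \<and> hd p = a \<and> last p = b"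
  proof (rule connected_on_induct[OF assms(1,2) _ _ assms(3)])
    show "\<exists>p. ipath E p \<and> p \<noteq> [] \<and> set p \<subseteq> S \<and> hd p = a \<and> last p = a"
      using assms by (intro exI[of _ "[a]"]) (auto simp: ipath_def)
    fix x y assume xy: "x \<in> S" "y \<in> S" "E x y"
      and "\<exists>p. ipath E p \<and> p \<noteq> [] \<and> set p \<subseteq> S \<and> hd p = a \<and> last p = x"
    then obtain p where p: "ipath E p" "p \<noteq> []" "set p \<subseteq> S" "hd p = a" "last p = x" by blast
    show "\<exists>p. ipath E p \<and> p \<noteq> [] \<and> set p \<subseteq> S \<and> hd p = a \<and> last p = y"
    proof (cases "y \<in> set p")
      case True
      then obtain i where i: "i < length p" "p ! i = y" by (auto simp: in_set_conv_nth)
      show ?thesis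
      proof (intro exI[of _ "take (Suc i) p"] conjI)
        show "set (take (Suc i) p) \<subseteq> S" using p(3) set_take_subset by fastforce
        show "last (take (Suc i) p) = y" using i by (simp add: take_Suc_conv_app_nth)
      qed (use p ipath_take in auto)
    next
      case False
      define i where "i = (LEAST i. i < length p \<and> E (p ! i) y)"
      have "length p - 1 < length p \<and> E (p ! (length p - 1)) y"
        using p xy by (auto simp: last_conv_nth)
      then have i: "i < length p \<and> E (p ! i) y"
        unfolding i_def by (rule LeastI)
      have less: "\<not> E (p ! j) y" if "j < i" for j
        using not_less_Least[of j "\<lambda>i. i < length p \<and> E (p ! i) y"] that i unfolding i_def[symmetric] by auto
      have "ipath E (take (Suc i) p @ [y])"
        unfolding ipath_def
      proof (intro conjI allI impI)
        show "distinct (take (Suc i) p @ [y])"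
          using False p(1) by (auto simp: ipath_def dest: in_set_takeD)
        have *: "E (p ! j) y \<longleftrightarrow> j = i" if "j < Suc i" for j
          using that i less[of j] by (cases "j = i") auto
        fix j k assume "j < length (take (Suc i) p @ [y])" "k < length (take (Suc i) p @ [y])"
        then have jk: "j < Suc (Suc i)" "k < Suc (Suc i)" using i by auto
        have **: "E (p ! j) (p ! k) \<longleftrightarrow> k = Suc j \<or> j = Suc k" if "j < Suc i" "k < Suc i" for j k
          using that i p(1) by (auto simp: ipath_def)
        show "E ((take (Suc i) p @ [y]) ! j) ((take (Suc i) p @ [y]) ! k) \<longleftrightarrow> k = Suc j \<or> j = Suc k"
          using i jk
          by (cases "j = Suc i"; cases "k = Suc i") (auto simp: nth_append min_def * ** edge_commute[of y])
      qed
      moreover have "set (take (Suc i) p @ [y]) \<subseteq> S"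
        using p(3) xy set_take_subset by fastforce
      ultimately show ?thesis
        using p(2,4) by (intro exI[of _ "take (Suc i) p @ [y]"]) auto
    qed
  qed
  then show ?thesis using that by blast
qed

text \<open>The cycle is closed by v and the segment of p up to the next neighbour of v.\<close>
lemma next_nbr_cycle:
  assumes "ipath E p" "set p \<subseteq> V" "v \<notin> set p" "i < k" "k < length p" "E v (p ! i)" "E v (p ! k)"
  obtains j vs where "i < j" "j \<le> k" "E v (p ! j)" "induced_cycle V E vs" "length vs = j - i + 2"
    "p ! i \<in> set vs" "p ! j \<in> set vs" "v \<in> set vs"
proof -
  define j where "j = (LEAST j. i < j \<and> E v (p ! j))"
  have j: "i < j \<and> E v (p ! j)" unfolding j_def by (rule LeastI[of _ k]) (use assms in auto)
  have jk: "j \<le> k" unfolding j_def by (rule Least_le) (use assms in auto)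
  have less: "\<not> E v (p ! l)" if "i < l" "l < j" for l
    using not_less_Least[of l "\<lambda>j. i < j \<and> E v (p ! j)"] that unfolding j_def[symmetric] by auto
  let ?q = "drop i (take (Suc j) p)"
  have len: "length ?q = Suc j - i" using jk assms by auto
  have nth: "?q ! l = p ! (i + l)" if "l < length ?q" for l
    using that len by auto
  have "v \<in> V" using assms edge_in by blast
  have "induced_cycle V E (v # ?q)"
    unfolding induced_cycle_Cons
  proof (intro conjI allI impI)
    show "set ?q \<subseteq> V" "v \<notin> set ?q" using assms by (auto dest!: in_set_dropD in_set_takeD)
    show "2 \<le> length ?q" using len j by auto
    show "ipath E ?q" using assms by (intro ipath_drop ipath_take)
    fix l assume l: "l < length ?q"
    show "E v (?q ! l) \<longleftrightarrow> l = 0 \<or> Suc l = length ?q"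
      using l less[of "i + l"] j assms len unfolding nth[OF l]
      by (cases "l = 0"; cases "i + l = j") auto
  qed fact
  moreover have "p ! i \<in> set ?q"
    using nth[of 0] len j nth_mem[of 0 ?q] by (metis Nat.add_0_right less_Suc_eq zero_less_diff less_trans)
  moreover have "p ! j \<in> set ?q"
    using nth[of "j - i"] len j nth_mem[of "j - i" ?q]
    by (metis diff_less_mono le_add_diff_inverse lessI less_imp_le)
  ultimately show ?thesis using that[of j "v # ?q"] j jk len by auto
qed

text \<open>An induced path has edges only between consecutive vertices, so every walk
  \<open>h\<close> of the same length gives a homomorphism on it; repetitions in \<open>h\<close>
  fold the path. One-point extension at \<open>v\<close> then yields a common neighbour of the
  images of the neighbours of \<open>v\<close>.\<close>

lemma ipath_ext:
  assumes ext: "one_point_ext V E" and p: "ipath E p" "set p \<subseteq> V" "p \<noteq> []" and v: "v \<in> V" "v \<notin> set p"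
    and h: "\<And>i. h i \<in> V" "\<And>i. Suc i < length p \<Longrightarrow> E (h i) (h (Suc i))"
  obtains w where "w \<in> V" "\<And>i. i < length p \<Longrightarrow> E (p ! i) v \<Longrightarrow> E (h i) w"
proof -
  \<comment> \<open>\<open>inv_into\<close> turns a vertex of the path back into its index.\<close>
  define f where "f x = h (inv_into {..<length p} ((!) p) x)" for x
  have f: "f (p ! i) = h i" if "i < length p" for i
    unfolding f_def using that p(1)
    by (subst inv_into_f_f) (auto simp: ipath_def inj_on_def nth_eq_iff_index_eq)
  have "ghom (set p) E V E f"
    using p(1) h edge_sym unfolding ghom_def
    by (auto simp: in_set_conv_nth f ipath_def)
  from one_point_extD[OF ext p(2) ipath_connected[OF p(1,3)] this v]
  obtain w where "w \<in> V" "\<And>u. u \<in> set p \<Longrightarrow> E u v \<Longrightarrow> E (f u) w" by metis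
  then show ?thesis using that[of w] f by (metis nth_mem)
qed

subsection \<open>Graphs whose induced cycles are squares\<close>

text \<open>The letters \<open>a\<close> to \<open>f\<close> stand for the vertices 1 to 6, the
  chord joining \<open>c\<close> and \<open>f\<close>. Of the 15 pairs, seven are edges and eight
  are not.\<close>

lemma embeds_two_squares_iff:
  "embeds two_squares_V two_squares_E V E \<longleftrightarrow>
    (\<exists>a b c d e f. {a, b, c, d, e, f} \<subseteq> V \<and> distinct [a, b, c, d, e, f] \<and>
      E a b \<and> E b c \<and> E c d \<and> E d e \<and> E e f \<and> E f a \<and> E c f \<and>
      \<not> E a c \<and> \<not> E a d \<and> \<not> E a e \<and> \<not> E b d \<and> \<not> E b e \<and> \<not> E b f \<and> \<not> E c e \<and> \<not> E d f)"
  (is "?L \<longleftrightarrow> ?R")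
proof -
  have V: "two_squares_V = {1, 2, 3, 4, 5, 6}"
    by (auto simp: two_squares_V_def)
  show ?thesis
  proof
    assume ?L
    then obtain g where g: "inj_on g two_squares_V" "g ` two_squares_V \<subseteq> V"
      "\<forall>x\<in>two_squares_V. \<forall>y\<in>two_squares_V. two_squares_E x y \<longleftrightarrow> E (g x) (g y)"
      unfolding embeds_def by (elim exE conjE) (rule that)
    have *: "E (g x) (g y) \<longleftrightarrow> two_squares_E x y" if "x \<in> {1,2,3,4,5,6}" "y \<in> {1,2,3,4,5,6}" for x y
      using g(3)[unfolded V, rule_format, OF that] by simp
    have inj: "g x = g y \<longleftrightarrow> x = y" if "x \<in> {1,2,3,4,5,6}" "y \<in> {1,2,3,4,5,6}" for x y
      by (rule inj_on_eq_iff[OF g(1)[unfolded V] that])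
    have sub: "{g 1, g 2, g 3, g 4, g 5, g 6} \<subseteq> V" using g(2) unfolding V by simp
    have dist: "distinct [g 1, g 2, g 3, g 4, g 5, g 6]" by (simp add: inj)
    show ?R
      by (rule exI[of _ "g 1"], rule exI[of _ "g 2"], rule exI[of _ "g 3"],
          rule exI[of _ "g 4"], rule exI[of _ "g 5"], rule exI[of _ "g 6"])
        (use sub dist in \<open>simp add: * two_squares_E_def doubleton_eq_iff\<close>)
  next
    assume ?R
    then obtain a b c d e f where *: "{a, b, c, d, e, f} \<subseteq> V" "distinct [a, b, c, d, e, f]"
      "E a b" "E b c" "E c d" "E d e" "E e f" "E f a" "E c f"
      "\<not> E a c" "\<not> E a d" "\<not> E a e" "\<not> E b d" "\<not> E b e" "\<not> E b f" "\<not> E c e" "\<not> E d f"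
      by (elim exE conjE) (rule that)
    let ?g = "\<lambda>n. [a, b, c, d, e, f] ! (n - 1)"
    have "\<forall>x\<in>two_squares_V. \<forall>y\<in>two_squares_V. two_squares_E x y \<longleftrightarrow> E (?g x) (?g y)"
      using * edge_commute[of b a] edge_commute[of c b] edge_commute[of d c] edge_commute[of e d]
        edge_commute[of f e] edge_commute[of a f] edge_commute[of f c] edge_commute[of c a]
        edge_commute[of d a] edge_commute[of e a] edge_commute[of d b] edge_commute[of e b]
        edge_commute[of f b] edge_commute[of e c] edge_commute[of f d]
      unfolding V by (simp add: two_squares_E_def doubleton_eq_iff)
    moreover have "inj_on ?g two_squares_V" "?g ` two_squares_V \<subseteq> V"
      using *(1,2) unfolding V by auto
    ultimately show ?L
      unfolding embeds_def by (intro exI[of _ ?g]) blast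
  qed
qed

lemma nbr_exists:
  assumes "card V \<noteq> 1" "x \<in> V"
  obtains y where "y \<in> V" "E x y"
proof -
  have "V \<noteq> {x}" using assms by auto
  then show ?thesis using connected_on_nbr[OF connected assms(2)] that by metis
qed

text \<open>Consecutive neighbours of v on a shortest path are two steps apart, so a shortest path with
  more than three vertices would produce two squares sharing an edge at v.\<close>
lemma square_graph_common_nbr:
  assumes cyc: "\<And>vs. induced_cycle V E vs \<Longrightarrow> length vs = 4"
    and no: "\<not> embeds two_squares_V two_squares_E V E"
    and S: "S \<subseteq> V" "connected_on E S" "v \<notin> S"
    and ab: "a \<in> S" "b \<in> S" "a \<noteq> b" "E v a" "E v b"
  obtains u where "u \<in> S" "E u a" "E u b"
proof -
  obtain p where p: "ipath E p" "p \<noteq> []" "set p \<subseteq> S" "hd p = a" "last p = b"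
    using ipath_exists[OF S(2) ab(1,2)] by metis
  define L where "L = length p - 1"
  have pV: "set p \<subseteq> V" and vp: "v \<notin> set p" using p S by auto
  have p0: "p ! 0 = a" using p by (simp add: hd_conv_nth)
  have pL: "p ! L = b" using p by (simp add: L_def last_conv_nth)
  have L: "L < length p" using p by (simp add: L_def)
  have L0: "0 < L" using p0 pL ab(3) by (metis neq0_conv)
  \<comment> \<open>Induced cycles have length 4, so the next neighbour of \<open>v\<close> on the
    path comes exactly two places later.\<close>
  have step: "E v (p ! (i + 2)) \<and> i + 2 \<le> L" if i: "E v (p ! i)" "i < L" for i
  proof -
    obtain j vs where "i < j" "j \<le> L" "E v (p ! j)" "induced_cycle V E vs" "length vs = j - i + 2"
      using next_nbr_cycle[OF p(1) pV vp i(2) L i(1)] pL ab(5) by metis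
    then have "j = i + 2" using cyc[of vs] by auto
    then show ?thesis using \<open>E v (p ! j)\<close> \<open>j \<le> L\<close> by simp
  qed
  have E2: "E v (p ! 2)" "2 \<le> L" using step[of 0] p0 ab L0 by (simp_all add: numeral_2_eq_2)
  have "L = 2"
  proof (rule ccontr)
    assume "L \<noteq> 2"
    then have E4: "E v (p ! 4)" "4 \<le> L" using step[of 2] E2 by auto
    have adj: "E (p ! i) (p ! j) \<longleftrightarrow> j = Suc i \<or> i = Suc j" if "i \<le> 4" "j \<le> 4" for i j
      using p(1) that L E4 by (auto simp: ipath_def)
    have eq: "p ! i = p ! j \<longleftrightarrow> i = j" if "i \<le> 4" "j \<le> 4" for i j
      using p(1) that L E4 by (auto simp: ipath_def nth_eq_iff_index_eq)
    have inp: "p ! i \<in> set p" if "i \<le> 4" for i using that L E4 by auto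
    \<comment> \<open>A neighbour of \<open>v\<close> at place 1 or 3, right after one at place 0 or
      2, would close an induced triangle.\<close>
    have tri: "\<not> E v (p ! i)" if "i \<in> {1, 3}" for i
    proof
      assume *: "E v (p ! i)"
      have "i < L" using that E4 by auto
      have "E v (p ! (i - 1))" using that E2 p0 ab by auto
      moreover have "i - 1 < i" "i < length p" using that E4 L by auto
      ultimately obtain j vs where "i - 1 < j" "j \<le> i" "induced_cycle V E vs" "length vs = j - (i - 1) + 2"
        using next_nbr_cycle[OF p(1) pV vp, of "i - 1" i] * by metis
      then show False using cyc[of vs] by auto
    qed
    have vne: "v \<noteq> p ! i" if "i \<le> 4" for i using inp[OF that] vp by auto
    \<comment> \<open>The squares are \<open>v\<close>, \<open>p ! 0\<close>, \<open>p ! 1\<close>,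
      \<open>p ! 2\<close> and \<open>v\<close>, \<open>p ! 2\<close>, \<open>p ! 3\<close>,
      \<open>p ! 4\<close>. Their shared edge, from \<open>v\<close> to \<open>p ! 2\<close>, is the
      chord.\<close>
    have "embeds two_squares_V two_squares_E V E"
      unfolding embeds_two_squares_iff
    proof (intro exI conjI)
      show "{p ! 1, p ! 0, v, p ! 4, p ! 3, p ! 2} \<subseteq> V"
        using inp pV ab(4) edge_in by auto
      show "distinct [p ! 1, p ! 0, v, p ! 4, p ! 3, p ! 2]"
        using vne vne[symmetric] by (simp add: eq)
    qed (use adj E2 E4 ab p0[symmetric] tri edge_commute[of _ v] in simp_all)
    then show False using no by blast
  qed
  then have "E (p ! 1) a" "E (p ! 1) b" "p ! 1 \<in> S"
    using p(2,3) L p0 pL ipath_edge_iff[OF p(1), of 1 0] ipath_edge_iff[OF p(1), of 1 2] by auto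
  then show ?thesis using that by blast
qed

text \<open>Any two neighbours of \<open>v\<close> in \<open>S\<close> have a common neighbour in
  \<open>S\<close>. In the absence of two squares this passes, by induction on finite sets, from
  pairs to all neighbours of \<open>v\<close> in \<open>S\<close> together.\<close>

lemma one_point_ext_square_graph:
  assumes cyc: "\<And>vs. induced_cycle V E vs \<Longrightarrow> length vs = 4"
    and no: "\<not> embeds two_squares_V two_squares_E V E"
  shows "one_point_ext V E"
  unfolding one_point_ext_def
proof (intro allI impI)
  fix S f v
  assume S: "S \<subseteq> V" and conn: "connected_on E S" and f: "ghom S E V E f" and v: "v \<in> V" "v \<notin> S"
  have card: "card V \<noteq> 1" if "u \<in> S" for u
    using that v S by (auto simp: card_1_singleton_iff)
  show "\<exists>w\<in>V. \<forall>u\<in>S. E u v \<longrightarrow> E (f u) w"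
  proof (cases "\<exists>s. S = {s}")
    \<comment> \<open>If \<open>S\<close> is a single vertex \<open>s\<close>, no neighbour of
      \<open>s\<close> is available inside \<open>S\<close>; any neighbour of \<open>f s\<close>
      will do.\<close>
    case True
    then obtain s where s: "S = {s}" by blast
    then have "f s \<in> V" using f by (auto simp: ghom_def)
    then show ?thesis using nbr_exists[OF card, of s "f s"] s by blast
  next
    case False
    have "\<exists>u\<in>S. \<forall>a\<in>A. E u a" if "finite A" "A \<noteq> {}" "A \<subseteq> {a\<in>S. E v a}" for A
      using that
    proof (induction A rule: finite_ne_induct)
      case (singleton x)
      then obtain y where "y \<in> S" "E x y" using connected_on_nbr[OF conn, of x] False by auto
      then show ?case using edge_sym by auto
    next
      case (insert c A)
      then obtain u where u: "u \<in> S" "\<forall>a\<in>A. E u a" by auto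
      obtain a where a: "a \<in> A" using insert by blast
      with insert have "a \<in> S" "c \<in> S" "a \<noteq> c" "E v a" "E v c" by auto
      then obtain u' where u': "u' \<in> S" "E u' a" "E u' c"
        using square_graph_common_nbr[OF cyc no S conn v(2)] by metis
      \<comment> \<open>Either \<open>u\<close> or \<open>u'\<close> serves for
        \<open>insert c A\<close>: if \<open>u\<close> misses \<open>c\<close> and \<open>u'\<close>
        misses some \<open>b\<close> in \<open>A\<close>, two squares appear.\<close>
      show ?case
      proof (rule ccontr)
        assume *: "\<not> ?case"
        then have uc: "\<not> E u c" using u by auto
        obtain b where b: "b \<in> A" "\<not> E u' b" using * u' by auto
        have tri: "\<not> (E x y \<and> E y z \<and> E x z)" for x y z
        proof
          assume xyz: "E x y \<and> E y z \<and> E x z"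
          then have "induced_cycle V E (x # [y, z])"
            unfolding induced_cycle_Cons
            using edge_in[of x y] edge_in[of y z] edge_sym[of x y] edge_sym[of y z] edge_sym[of x z] edge_irrefl
            by (auto simp: ipath_def less_Suc_eq)
          then show False using cyc by fastforce
        qed
        have "b \<in> S" "E v b" using b insert by auto
        have non: "\<not> E b c" "\<not> E b a" "\<not> E c a" "\<not> E u v" "\<not> E v u'" "\<not> E u u'"
          using tri[of v b c] tri[of v b a] tri[of v c a] tri[of u a v] tri[of v a u'] tri[of u a u']
            u u' a \<open>E v a\<close> \<open>E v b\<close> \<open>E v c\<close> edge_sym by blast+
        have edges: "E u b" "E b v" "E v c" "E c u'" "E u' a" "E a u" "E v a" "\<not> E b u'"
          using u u' a b edge_sym \<open>E v a\<close> \<open>E v b\<close> \<open>E v c\<close> by blast+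
        have "distinct [u, b, v, c, u', a]"
          using non edges uc b(2) u u' v \<open>a \<in> S\<close> \<open>c \<in> S\<close> \<open>b \<in> S\<close> edge_irrefl edge_sym
          by (simp only: distinct.simps list.set insert_iff empty_iff simp_thms) metis
        \<comment> \<open>The squares v a u b and v a u' c share the edge v a.\<close>
        have "embeds two_squares_V two_squares_E V E"
          unfolding embeds_two_squares_iff
        proof (intro exI conjI)
          show "{u, b, v, c, u', a} \<subseteq> V"
            using u u' \<open>a \<in> S\<close> \<open>c \<in> S\<close> \<open>b \<in> S\<close> v S by auto
        qed fact+
        then show False using no by blast
      qed
    qed
    moreover have "finite {a\<in>S. E v a}" using finite_subset[OF S finite] by simp
    ultimately have *: "{a\<in>S. E v a} \<noteq> {} \<Longrightarrow> \<exists>u\<in>S. \<forall>a\<in>{a\<in>S. E v a}. E u a" by blast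
    show ?thesis
    proof (cases "{a\<in>S. E v a} = {}")
      case True
      then show ?thesis using v edge_sym by blast
    next
      case False
      then obtain u where u: "u \<in> S" "\<forall>a\<in>{a\<in>S. E v a}. E u a" using * by blast
      have "E (f a) (f u)" if "a \<in> S" "E a v" for a
        using u that f edge_sym unfolding ghom_def by blast
      moreover have "f u \<in> V" using f u by (auto simp: ghom_def)
      ultimately show ?thesis by blast
    qed
  qed
qed

subsection \<open>Cliques and treelike graphs\<close>

definition clique :: "'a set \<Rightarrow> bool" where
  "clique Q \<longleftrightarrow> Q \<subseteq> V \<and> (\<forall>x\<in>Q. \<forall>y\<in>Q. x \<noteq> y \<longrightarrow> E x y)"

lemma cliqueD: "clique Q \<Longrightarrow> x \<in> Q \<Longrightarrow> y \<in> Q \<Longrightarrow> x \<noteq> y \<Longrightarrow> E x y"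
  by (auto simp: clique_def)

lemma clique_finite: "clique Q \<Longrightarrow> finite Q"
  using finite_subset[OF _ finite] by (auto simp: clique_def)

lemma triangle_induced_cycle:
  assumes "E x y" "E y z" "E x z"
  shows "induced_cycle V E [x, y, z]"
  unfolding induced_cycle_Cons
  using assms edge_in[of x y] edge_in[of y z] edge_sym[of x y] edge_sym[of y z] edge_sym[of x z]
  by (auto simp: ipath_def less_Suc_eq)

text \<open>The neighbours of \<open>v\<close> in \<open>S\<close> form a clique together with
  \<open>v\<close>, so they lie in one component and number fewer than \<open>n\<close>. Their
  images form a clique too, inside a component that still has a vertex to spare for
  \<open>v\<close>.\<close>

lemma one_point_ext_treelike:
  assumes n: "n \<ge> 2" and T: "Kn_treelike n V E"
  shows "one_point_ext V E"
proof -
  obtain \<C> where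
      comp: "\<forall>C\<in>\<C>. C \<subseteq> V \<and> card C = n \<and> (\<forall>x\<in>C. \<forall>y\<in>C. x \<noteq> y \<longrightarrow> E x y)"
    and cover: "\<Union>\<C> = V"
    and edge: "\<forall>x y. E x y \<longrightarrow> (\<exists>C\<in>\<C>. x \<in> C \<and> y \<in> C)"
    and int: "\<forall>C\<in>\<C>. \<forall>D\<in>\<C>. C \<noteq> D \<longrightarrow> card (C \<inter> D) \<le> 1"
    and cyc: "\<forall>vs. induced_cycle V E vs \<longrightarrow> (\<exists>C\<in>\<C>. set vs \<subseteq> C)"
    using T unfolding Kn_treelike_def by (elim exE conjE) (rule that)
  note comp = bspec[OF comp] and edge = edge[rule_format] and cyc = cyc[rule_format]
  have fin: "finite C" if "C \<in> \<C>" for C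
    using comp[OF that] finite_subset[OF _ finite] by blast
  have eq: "C = D" if "C \<in> \<C>" "D \<in> \<C>" "x \<in> C \<inter> D" "y \<in> C \<inter> D" "x \<noteq> y" for C D x y
  proof (rule ccontr)
    assume "C \<noteq> D"
    then have "card (C \<inter> D) \<le> 1" using int that by blast
    moreover have "card {x, y} \<le> card (C \<inter> D)"
      using that fin by (intro card_mono) auto
    ultimately show False using that(5) by simp
  qed
  \<comment> \<open>An edge lies in only one component. With any third vertex of \<open>Q\<close> it
    forms a triangle, which is an induced cycle, so the third vertex lies in that component as
    well.\<close>
  have clique_in: "\<exists>D\<in>\<C>. Q \<subseteq> D" if Q: "clique Q" "Q \<noteq> {}" for Q
  proof -
    obtain a where a: "a \<in> Q" using Q by blast
    show ?thesis
    proof (cases "Q = {a}")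
      case True
      then show ?thesis using Q cover by (auto simp: clique_def)
    next
      case False
      then obtain b where b: "b \<in> Q" "a \<noteq> b" using a by blast
      then have ab: "E a b" using Q a cliqueD by blast
      then obtain D where D: "D \<in> \<C>" "a \<in> D" "b \<in> D" using edge by blast
      have "c \<in> D" if c: "c \<in> Q" for c
      proof (cases "c = a \<or> c = b")
        case False
        then have "E b c" "E a c" using Q a b c cliqueD by blast+
        then obtain D' where "D' \<in> \<C>" "set [a, b, c] \<subseteq> D'"
          using cyc triangle_induced_cycle ab by blast
        then show ?thesis using eq[of D D' a b] D b by auto
      qed (use D in auto)
      then show ?thesis using D by blast
    qed
  qed
  show ?thesis
    unfolding one_point_ext_def
  proof (intro allI impI)
    fix S f v
    assume S: "S \<subseteq> V" and conn: "connected_on E S" and f: "ghom S E V E f" and v: "v \<in> V" "v \<notin> S"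
    define A where "A = {a\<in>S. E v a}"
    \<comment> \<open>On an induced path in \<open>S\<close> from \<open>a\<close> to
      \<open>b\<close>, successive neighbours of \<open>v\<close> share a component with
      \<open>v\<close> and are therefore consecutive. Two such steps in a row would stay in one
      component and give a chord, so the path is a single edge.\<close>
    have adj: "E a b" if ab: "a \<in> A" "b \<in> A" "a \<noteq> b" for a b
    proof -
      have abS: "a \<in> S" "b \<in> S" "E v a" "E v b" using ab by (auto simp: A_def)
      obtain p where p: "ipath E p" "p \<noteq> []" "set p \<subseteq> S" "hd p = a" "last p = b"
        using ipath_exists[OF conn abS(1,2)] by metis
      define L where "L = length p - 1"
      have pV: "set p \<subseteq> V" and vp: "v \<notin> set p" using p S v by auto
      have p0: "p ! 0 = a" using p by (simp add: hd_conv_nth)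
      have pL: "p ! L = b" using p by (simp add: L_def last_conv_nth)
      have L: "L < length p" using p by (simp add: L_def)
      have L0: "0 < L" using p0 pL ab(3) by (metis neq0_conv)
      have inp: "p ! i \<in> set p" if "i \<le> L" for i using that L by auto
      have step: "Suc i \<le> L \<and> E v (p ! Suc i) \<and> (\<exists>C\<in>\<C>. p ! i \<in> C \<and> p ! Suc i \<in> C \<and> v \<in> C)"
        if i: "E v (p ! i)" "i < L" for i
      proof -
        obtain j vs where j: "i < j" "j \<le> L" "E v (p ! j)" "induced_cycle V E vs"
          "p ! i \<in> set vs" "p ! j \<in> set vs" "v \<in> set vs"
          using next_nbr_cycle[OF p(1) pV vp i(2) L i(1)] pL abS by metis
        then obtain C where C: "C \<in> \<C>" "set vs \<subseteq> C" using cyc by blast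
        have "p ! i \<noteq> p ! j" using j L p(1) by (auto simp: ipath_def nth_eq_iff_index_eq)
        then have "E (p ! i) (p ! j)" using comp[OF C(1)] C(2) j by blast
        then have "j = Suc i" using j L p(1) by (auto simp: ipath_def)
        then show ?thesis using j C by blast
      qed
      obtain C where C: "C \<in> \<C>" "p ! 0 \<in> C" "p ! Suc 0 \<in> C" "v \<in> C" and v1: "E v (p ! Suc 0)"
        using step[of 0] abS p0 L0 by auto
      have "L = 1"
      proof (rule ccontr)
        assume "L \<noteq> 1"
        then have L2: "Suc 0 < L" using L0 by simp
        from step[OF v1 L2] obtain D
          where D: "D \<in> \<C>" "p ! Suc 0 \<in> D" "p ! Suc (Suc 0) \<in> D" "v \<in> D" by blast
        have "v \<noteq> p ! Suc 0" using vp inp[of "Suc 0"] L2 by auto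
        then have "C = D" using eq[of C D v "p ! Suc 0"] C D by blast
        moreover have "p ! 0 \<noteq> p ! Suc (Suc 0)" using ipath_nth_eq_iff[OF p(1), of 0 "Suc (Suc 0)"] L2 L p(2) by auto
        ultimately have "E (p ! 0) (p ! Suc (Suc 0))" using comp[OF C(1)] C D by blast
        then show False using ipath_edge_iff[OF p(1), of 0 "Suc (Suc 0)"] L2 L p(2) by auto
      qed
      then show ?thesis using p0 pL L p(2) ipath_edge_iff[OF p(1), of 0 1] by auto
    qed
    show "\<exists>w\<in>V. \<forall>u\<in>S. E u v \<longrightarrow> E (f u) w"
    proof (cases "A = {}")
      case True
      then have "\<not> E u v" if "u \<in> S" for u using that edge_sym[of u v] by (auto simp: A_def)
      then show ?thesis using v(1) by blast
    next
      case False
      have AV: "A \<subseteq> V" and vA: "v \<notin> A" using S v by (auto simp: A_def)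
      have "clique (insert v A)"
        using AV v adj unfolding clique_def by (auto simp: A_def edge_commute[of _ v])
      then obtain C where C: "C \<in> \<C>" "insert v A \<subseteq> C" using clique_in by blast
      have "card (insert v A) \<le> n" using card_mono[OF fin C(2)] C comp by auto
      moreover have "finite A" using AV finite finite_subset by blast
      ultimately have cA: "card A < n" using vA by simp
      have "clique (f ` A)"
        unfolding clique_def
      proof (intro conjI ballI impI)
        show "f ` A \<subseteq> V" using f by (auto simp: ghom_def A_def)
        fix x y assume "x \<in> f ` A" "y \<in> f ` A" "x \<noteq> y"
        then obtain a b where "x = f a" "y = f b" "a \<in> A" "b \<in> A" "a \<noteq> b" by blast
        then show "E x y" using f adj[of a b] by (auto simp: ghom_def A_def)
      qed
      then obtain D where D: "D \<in> \<C>" "f ` A \<subseteq> D" using clique_in False by blast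
      have "card (f ` A) < card D"
        using card_image_le[OF \<open>finite A\<close>, of f] cA comp[OF D(1)] by simp
      then have "\<not> D \<subseteq> f ` A" using card_mono[of "f ` A" D] \<open>finite A\<close> by auto
      then obtain w where w: "w \<in> D" "w \<notin> f ` A" by blast
      have "E (f u) w" if "u \<in> S" "E u v" for u
      proof -
        have "f u \<in> f ` A" using that edge_sym by (auto simp: A_def)
        then have "f u \<in> D" "f u \<noteq> w" using D w by blast+
        then show ?thesis using w comp[OF D(1)] by blast
      qed
      then show ?thesis using w comp[OF D(1)] by blast
    qed
  qed
qed

subsection \<open>Bipartite graphs\<close>

definition bipartition :: "'a set \<Rightarrow> 'a set \<Rightarrow> bool" where
  "bipartition X Y \<longleftrightarrow> X \<inter> Y = {} \<and> X \<union> Y = V \<and>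
      (\<forall>x y. E x y \<longrightarrow> (x \<in> X \<and> y \<in> Y) \<or> (x \<in> Y \<and> y \<in> X))"

lemma bipartition_commute: "bipartition X Y \<Longrightarrow> bipartition Y X"
  by (auto simp: bipartition_def)

text \<open>On a connected \<open>S\<close> a homomorphism either keeps every vertex on its side or
  switches every vertex. So the images of the neighbours of \<open>v\<close> lie in one part and are
  at most as many as the degree of \<open>v\<close>; \<open>nbr\<close> is about such sets.\<close>

lemma one_point_ext_bipartite:
  assumes XY: "bipartition X Y"
    and nbr: "\<And>v A. v \<in> V \<Longrightarrow> card A \<le> card {u. E u v} \<Longrightarrow> A \<subseteq> X \<or> A \<subseteq> Y \<Longrightarrow> \<exists>w\<in>V. \<forall>a\<in>A. E a w"
  shows "one_point_ext V E"
  unfolding one_point_ext_def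
proof (intro allI impI)
  fix S f v
  assume S: "S \<subseteq> V" and conn: "connected_on E S" and f: "ghom S E V E f" and v: "v \<in> V" "v \<notin> S"
  obtain r where r: "r \<in> S" using conn by (auto simp: connected_on_def)
  \<comment> \<open>Each half of the outer equivalence says whether \<open>f\<close> preserves the
    side of that vertex. Crossing an edge flips both memberships, so the answer stays the
    same.\<close>
  have side: "(x \<in> X \<longleftrightarrow> f x \<in> X) \<longleftrightarrow> (r \<in> X \<longleftrightarrow> f r \<in> X)" if "x \<in> S" for x
  proof (rule connected_on_induct[OF conn r, of "\<lambda>x. (x \<in> X \<longleftrightarrow> f x \<in> X) \<longleftrightarrow> (r \<in> X \<longleftrightarrow> f r \<in> X)"])
    fix x y assume "x \<in> S" "y \<in> S" and xy: "E x y"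
      and IH: "(x \<in> X \<longleftrightarrow> f x \<in> X) \<longleftrightarrow> (r \<in> X \<longleftrightarrow> f r \<in> X)"
    then have "E (f x) (f y)" using f by (auto simp: ghom_def)
    then have "x \<in> X \<longleftrightarrow> y \<notin> X" "f x \<in> X \<longleftrightarrow> f y \<notin> X"
      using XY xy unfolding bipartition_def by blast+
    then show "(y \<in> X \<longleftrightarrow> f y \<in> X) \<longleftrightarrow> (r \<in> X \<longleftrightarrow> f r \<in> X)" using IH by blast
  qed (use that in auto)
  let ?A = "{u\<in>S. E u v}"
  have "f u \<in> X \<longleftrightarrow> f u' \<in> X" if "u \<in> ?A" "u' \<in> ?A" for u u'
  proof -
    have "u \<in> X \<longleftrightarrow> u' \<in> X" using that XY unfolding bipartition_def by blast
    then show ?thesis using side[of u] side[of u'] that by blast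
  qed
  moreover have "f ` ?A \<subseteq> X \<union> Y" using f XY by (auto simp: ghom_def bipartition_def)
  ultimately have one_side: "f ` ?A \<subseteq> X \<or> f ` ?A \<subseteq> Y" by blast
  have "finite {u. E u v}"
    using finite_subset[OF _ finite, of "{u. E u v}"] edge_in by blast
  then have "card ?A \<le> card {u. E u v}" and "finite ?A"
    by (auto intro!: card_mono elim: rev_finite_subset)
  then have "card (f ` ?A) \<le> card {u. E u v}"
    using card_image_le[of ?A f] by linarith
  from nbr[OF v(1) this one_side] show "\<exists>w\<in>V. \<forall>u\<in>S. E u v \<longrightarrow> E (f u) w" by auto
qed

lemma one_point_ext_bip_common_nbrs:
  assumes "bip_common_nbrs V E"
  shows "one_point_ext V E"
proof -
  obtain X Y where XY: "bipartition X Y" and "\<exists>a\<in>V. \<forall>x\<in>X. E a x" "\<exists>b\<in>V. \<forall>y\<in>Y. E b y"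
    using assms unfolding bip_common_nbrs_def
    by (elim exE conjE) (rule that, unfold bipartition_def, intro conjI)
  then obtain a b where ab: "a \<in> V" "b \<in> V" "\<forall>x\<in>X. E a x" "\<forall>y\<in>Y. E b y"
    by blast
  show ?thesis
    by (rule one_point_ext_bipartite[OF XY]) (use ab edge_sym in blast)
qed

text \<open>Degrees are below \<open>n\<close>, whereas each part has \<open>n\<close> vertices. A
  set \<open>A\<close> no larger than a degree thus misses some \<open>F (b, i)\<close> in its part,
  and the vertex of index \<open>i\<close> in the other part is adjacent to all of
  \<open>A\<close>.\<close>

lemma one_point_ext_bcpm:
  assumes "isomorphic (bcpm_V n) (bcpm_E n) V E"
  shows "one_point_ext V E"
proof -
  obtain F where F: "bij_betw F (bcpm_V n) V"
    "\<forall>x\<in>bcpm_V n. \<forall>y\<in>bcpm_V n. bcpm_E n x y \<longleftrightarrow> E (F x) (F y)"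
    using assms unfolding isomorphic_def by (elim exE conjE) (rule that)
  have E_F: "E (F (b, i)) (F (c, j)) \<longleftrightarrow> b \<noteq> c \<and> i \<noteq> j" if "i < n" "j < n" for b c i j
    using F(2) that by (auto simp: bcpm_V_def bcpm_E_def)
  have F_eq: "F (b, i) = F (c, j) \<longleftrightarrow> b = c \<and> i = j" if "i < n" "j < n" for b c i j
    using inj_on_eq_iff[OF bij_betw_imp_inj_on[OF F(1)], of "(b, i)" "(c, j)"] that
    by (auto simp: bcpm_V_def)
  have FV: "\<exists>b i. i < n \<and> x = F (b, i)" if "x \<in> V" for x
    using bij_betw_imp_surj_on[OF F(1)] that by (auto simp: bcpm_V_def)
  have VF: "F (b, i) \<in> V" if "i < n" for b i
    using bij_betw_imp_surj_on[OF F(1)] that by (auto simp: bcpm_V_def)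
  define P where "P b = (\<lambda>i. F (b, i)) ` {..<n}" for b
  have bip: "bipartition (P False) (P True)"
    unfolding bipartition_def
  proof (intro conjI allI impI)
    show "P False \<inter> P True = {}" by (auto simp: P_def F_eq)
    show "P False \<union> P True = V"
    proof
      show "V \<subseteq> P False \<union> P True"
      proof
        fix x assume "x \<in> V"
        then obtain b i where "i < n" "x = F (b, i)" using FV by blast
        then show "x \<in> P False \<union> P True" by (cases b) (auto simp: P_def)
      qed
    qed (auto simp: P_def VF)
    fix x y assume "E x y"
    then obtain b i c j where "x = F (b, i)" "i < n" "y = F (c, j)" "j < n"
      using edge_in FV by metis
    then show "x \<in> P False \<and> y \<in> P True \<or> x \<in> P True \<and> y \<in> P False"
      using \<open>E x y\<close> by (cases b; cases c) (auto simp: E_F P_def)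
  qed
  show ?thesis
  proof (rule one_point_ext_bipartite[OF bip])
    fix v A assume v: "v \<in> V" and A: "card A \<le> card {u. E u v}" "A \<subseteq> P False \<or> A \<subseteq> P True"
    then obtain b where b: "A \<subseteq> P b" by blast
    obtain c k where k: "k < n" "v = F (c, k)" using FV v by blast
    have "{u. E u v} \<subseteq> (\<lambda>i. F (\<not> c, i)) ` ({..<n} - {k})"
    proof
      fix u assume "u \<in> {u. E u v}"
      then have u: "E u v" by simp
      then obtain d i where "i < n" "u = F (d, i)" using FV edge_in by metis
      then show "u \<in> (\<lambda>i. F (\<not> c, i)) ` ({..<n} - {k})" using u k by (auto simp: E_F)
    qed
    then have "card {u. E u v} \<le> card ((\<lambda>i. F (\<not> c, i)) ` ({..<n} - {k}))"
      by (intro card_mono) auto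
    also have "\<dots> \<le> card ({..<n} - {k})" by (rule card_image_le) simp
    also have "\<dots> < n" using k by simp
    finally have "card A < n" using A by simp
    moreover have "card (P b) = n"
      unfolding P_def by (subst card_image) (auto simp: inj_on_def F_eq)
    ultimately have "A \<noteq> P b" by auto
    then obtain i where i: "i < n" "F (b, i) \<notin> A" using b by (auto simp: P_def)
    have "\<forall>a\<in>A. E a (F (\<not> b, i))" using b i by (auto simp: P_def E_F)
    then show "\<exists>w\<in>V. \<forall>a\<in>A. E a w" using VF[OF i(1)] by blast
  qed
qed

subsection \<open>Graphs with a triangle\<close>

lemma clique_insert:
  assumes "clique Q" "w \<in> V" "\<And>q. q \<in> Q \<Longrightarrow> E q w"
  shows "clique (insert w Q)"
  using assms edge_sym unfolding clique_def by blast

lemma clique_connected: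
  assumes "clique Q" "a \<in> Q"
  shows "connected_on E Q"
proof (rule connected_onI[OF edge_sym assms(2)])
  fix U assume U: "a \<in> U" "\<And>x y. x \<in> U \<Longrightarrow> x \<in> Q \<Longrightarrow> y \<in> Q \<Longrightarrow> E x y \<Longrightarrow> y \<in> U"
  show "Q \<subseteq> U"
  proof
    fix x assume "x \<in> Q"
    then show "x \<in> U" using U assms cliqueD[OF assms(1), of a x] by (cases "x = a") auto
  qed
qed

text \<open>A subset \<open>P\<close> of \<open>K\<close> of the size of \<open>Q\<close> is mapped
  bijectively onto \<open>Q\<close>. Extending this homomorphism to another vertex of
  \<open>K\<close> gives a vertex adjacent to all of \<open>Q\<close>; repetition brings
  \<open>Q\<close> up to the size of \<open>K\<close>.\<close>

lemma one_point_ext_clique_extend: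
  assumes ext: "one_point_ext V E" and K: "clique K" and Q: "clique Q" "Q \<noteq> {}" "card Q \<le> card K"
  obtains R where "clique R" "card R = card K" "Q \<subseteq> R"
proof -
  have "\<exists>R. clique R \<and> card R = card K \<and> Q \<subseteq> R"
    using Q
  proof (induction "card K - card Q" arbitrary: Q)
    case 0
    then show ?case by (intro exI[of _ Q]) auto
  next
    case (Suc m)
    obtain P where P: "P \<subseteq> K" "card P = card Q"
      using obtain_subset_with_card_n[OF Suc.prems(3)] by metis
    then have "P \<noteq> K" using Suc(2) by auto
    then obtain v where v: "v \<in> K" "v \<notin> P" using P by blast
    have Pc: "clique P" using P K by (auto simp: clique_def)
    have "card Q \<noteq> 0" using Suc.prems clique_finite by auto
    then obtain a where a: "a \<in> P" using P by (metis card.empty ex_in_conv)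
    obtain f where f: "bij_betw f P Q"
      using finite_same_card_bij[OF clique_finite[OF Pc] clique_finite[OF Suc.prems(1)] P(2)] by blast
    have hom: "ghom P E V E f"
      unfolding ghom_def
    proof (intro conjI ballI impI)
      show "f x \<in> V" if "x \<in> P" for x
        using bij_betw_apply[OF f that] Suc.prems(1) by (auto simp: clique_def)
      fix x y assume "x \<in> P" "y \<in> P" "E x y"
      then show "E (f x) (f y)"
        using bij_betw_apply[OF f] bij_betw_imp_inj_on[OF f] cliqueD[OF Suc.prems(1)]
        by (metis edge_irrefl inj_on_eq_iff)
    qed
    have "P \<subseteq> V" "v \<in> V" using Pc K v by (auto simp: clique_def)
    from one_point_extD[OF ext this(1) clique_connected[OF Pc a] hom this(2) v(2)]
    obtain w where w: "w \<in> V" "\<And>u. u \<in> P \<Longrightarrow> E u v \<Longrightarrow> E (f u) w" by metis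
    have wQ: "E q w" if q: "q \<in> Q" for q
    proof -
      obtain u where "u \<in> P" "q = f u" using f q by (auto simp: bij_betw_def)
      then show ?thesis using w(2)[of u] cliqueD[OF K, of u v] P v by blast
    qed
    then have "w \<notin> Q" by (metis edge_irrefl)
    then have card: "card (insert w Q) = Suc (card Q)" using clique_finite[OF Suc.prems(1)] by simp
    have "m = card K - card (insert w Q)" "card (insert w Q) \<le> card K" using card Suc(2) by auto
    then obtain R where "clique R" "card R = card K" "insert w Q \<subseteq> R"
      using Suc(1)[of "insert w Q"] clique_insert[OF Suc.prems(1) w(1) wQ] by blast
    then show ?case by blast
  qed
  then show ?thesis using that by blast
qed

text \<open>If d had two neighbours a, b in K, then sending d to b and fixing K - {b} would force the
  image of b to enlarge K.\<close>
lemma max_clique_nbr_unique: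
  assumes ext: "one_point_ext V E" and K: "clique K" and max: "\<And>Q. clique Q \<Longrightarrow> card Q \<le> card K"
    and d: "d \<notin> K" and ab: "a \<in> K" "b \<in> K" "E d a" "E d b"
  shows "a = b"
proof (rule ccontr)
  assume "a \<noteq> b"
  let ?S = "insert d (K - {b})" and ?f = "id(d := b)"
  have KV: "K \<subseteq> V" using K by (simp add: clique_def)
  have S: "?S \<subseteq> V" using KV edge_in ab by blast
  have Kb: "clique (K - {b})" using K by (auto simp: clique_def)
  \<comment> \<open>\<open>d\<close> is attached through \<open>a\<close>, which is still present
    because it differs from \<open>b\<close>.\<close>
  have conn: "connected_on E ?S"
    using connected_on_insert[OF clique_connected[OF Kb, of a], of a d] ab \<open>a \<noteq> b\<close> edge_sym by blast
  have hom: "ghom ?S E V E ?f"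
    unfolding ghom_def
  proof (intro conjI ballI impI)
    show "?f x \<in> V" if "x \<in> ?S" for x using that KV ab by auto
    fix x y assume "x \<in> ?S" "y \<in> ?S" "E x y"
    then show "E (?f x) (?f y)"
      using cliqueD[OF K, of x b] cliqueD[OF K, of b y] ab(2) by auto
  qed
  have "b \<in> V" "b \<notin> ?S" using KV ab d by auto
  from one_point_extD[OF ext S conn hom this] obtain w
    where w: "w \<in> V" "\<And>u. u \<in> ?S \<Longrightarrow> E u b \<Longrightarrow> E (?f u) w" by metis
  have Kw: "E q w" if "q \<in> K" for q
  proof (cases "q = b")
    case True then show ?thesis using w(2)[of d] ab by simp
  next
    case False
    then show ?thesis using w(2)[of q] that d cliqueD[OF K that ab(2)] by (auto split: if_splits)
  qed
  then have "w \<notin> K" by (metis edge_irrefl)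
  then have "card (insert w K) = Suc (card K)" using clique_finite[OF K] by simp
  then show False using max[OF clique_insert[OF K w(1) Kw]] by simp
qed

lemma ipath_Cons:
  assumes "ipath E p" "v \<notin> set p" "\<And>i. i < length p \<Longrightarrow> E v (p ! i) \<longleftrightarrow> i = 0"
  shows "ipath E (v # p)"
  unfolding ipath_def
proof (intro conjI allI impI)
  show "distinct (v # p)" using assms by (auto simp: ipath_def)
  fix i j assume "i < length (v # p)" "j < length (v # p)"
  then show "E ((v # p) ! i) ((v # p) ! j) \<longleftrightarrow> j = Suc i \<or> i = Suc j"
    using assms(1,3) edge_commute[of _ v] by (cases i; cases j) (auto simp: ipath_def)
qed

text \<open>By induction, shorter induced cycles are triangles. A vertex \<open>t\<close> lying with
  \<open>v\<close> and \<open>p ! L\<close> in a largest clique \<open>R\<close> has no other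
  neighbour on the cycle. Folding \<open>p\<close> while fixing \<open>t\<close> and
  \<open>p ! L\<close> forces the image of \<open>v\<close> into \<open>R\<close>, but also next to
  the image of \<open>p ! 0\<close>, whose only neighbour in \<open>R\<close> is
  \<open>p ! L\<close>: a contradiction.\<close>

lemma max_clique_no_long_cycle:
  assumes ext: "one_point_ext V E" and K: "clique K" "3 \<le> card K"
    and max: "\<And>Q. clique Q \<Longrightarrow> card Q \<le> card K"
  shows "induced_cycle V E vs \<Longrightarrow> length vs = 3"
proof (induction "length vs" arbitrary: vs rule: less_induct)
  case less
  show ?case
  proof (rule ccontr)
    assume "length vs \<noteq> 3"
    obtain v p where vp: "vs = v # p" "v \<in> V" "set p \<subseteq> V" "2 \<le> length p" "v \<notin> set p" "ipath E p"
      "\<And>i. i < length p \<Longrightarrow> E v (p ! i) \<longleftrightarrow> i = 0 \<or> Suc i = length p"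
      using induced_cycle_cases[OF less(2)] by metis
    define L where "L = length p - 1"
    have L: "2 \<le> L" "length p = Suc L" using vp(1,4) \<open>length vs \<noteq> 3\<close> by (auto simp: L_def)
    have v_adj: "E v (p ! i) \<longleftrightarrow> i = 0 \<or> i = L" if "i \<le> L" for i using vp(7)[of i] that L by auto
    have p_adj: "E (p ! i) (p ! j) \<longleftrightarrow> j = Suc i \<or> i = Suc j" if "i \<le> L" "j \<le> L" for i j
      using ipath_edge_iff[OF vp(6)] that L by simp
    have p_eq: "p ! i = p ! j \<longleftrightarrow> i = j" if "i \<le> L" "j \<le> L" for i j
      using ipath_nth_eq_iff[OF vp(6)] that L by simp
    have pV: "p ! i \<in> V" if "i \<le> L" for i using vp(3) that L by auto
    have pv: "v \<noteq> p ! i" if "i \<le> L" for i using vp(5) that L by auto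
    have edge_in_max: "\<exists>R. clique R \<and> card R = card K \<and> x \<in> R \<and> y \<in> R" if "E x y" for x y
    proof -
      have "clique {x, y}" using that edge_in edge_sym by (auto simp: clique_def)
      moreover have "card {x, y} \<le> card K" using K card_2_iff[of "{x,y}"] that edge_irrefl by (metis max calculation)
      ultimately show ?thesis using one_point_ext_clique_extend[OF ext K(1), of "{x, y}"] by auto
    qed
    have third: "\<exists>t\<in>R. t \<noteq> x \<and> t \<noteq> y" if "card R = card K" for R :: "'a set" and x y
      using third_element[of R x y] that K(2) by metis
    have uniq: "a = b" if "clique R" "card R = card K" "d \<notin> R" "a \<in> R" "b \<in> R" "E d a" "E d b" for R a b d
      using max_clique_nbr_unique[OF ext that(1) _ that(3-7)] max that(2) by simp
    obtain R where R: "clique R" "card R = card K" "v \<in> R" "p ! L \<in> R"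
      using edge_in_max[of v "p ! L"] v_adj by auto
    obtain t where t: "t \<in> R" "t \<noteq> v" "t \<noteq> p ! L" using third[OF R(2)] by blast
    have tv: "E t v" "E t (p ! L)" using cliqueD[OF R(1)] t R by auto
    have out: "p ! i \<notin> R" if "i < L" for i
    proof
      assume "p ! i \<in> R"
      moreover have "p ! i \<noteq> p ! L" "p ! i \<noteq> v" using p_eq[of i L] pv[of i] that by auto
      ultimately have "E (p ! i) (p ! L)" "E v (p ! i)" using cliqueD[OF R(1)] R by auto
      then show False using p_adj[of i L] v_adj[of i] that L by auto
    qed
    have t_p: "t \<noteq> p ! i" if "i \<le> L" for i using out[of i] t that by (cases "i = L") auto
    have t0: "\<not> E t (p ! 0)"
      using uniq[OF R(1,2) out[of 0] t(1) R(3)] t v_adj[of 0] L edge_sym by auto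
    have t1: "\<not> E t (p ! (L - 1))"
      using uniq[OF R(1,2) out[of "L - 1"] t(1) R(4)] t p_adj[of "L - 1" L] L edge_sym by auto
    have t_adj: "\<not> E t (p ! i)" if "i < L" for i
    proof
      assume ti: "E t (p ! i)"
      with t0 t1 have i: "i \<noteq> 0" "i \<noteq> L - 1" by (metis, metis)
      \<comment> \<open>The cycle without \<open>p ! L\<close> is an induced path starting at
        \<open>v\<close>. A further neighbour of \<open>t\<close> on it would close with
        \<open>t\<close> a shorter induced cycle, which is not a triangle since \<open>t\<close>
        misses \<open>p ! 0\<close>.\<close>
      let ?q = "v # take L p"
      have q: "ipath E ?q"
        by (rule ipath_Cons[OF ipath_take[OF vp(6)]]) (use vp(5) v_adj L in \<open>auto dest: in_set_takeD\<close>)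
      have qV: "set ?q \<subseteq> V" using vp(2,3) by (auto dest: in_set_takeD)
      have "t \<notin> set p" using t_p L by (auto simp: in_set_conv_nth less_Suc_eq_le)
      then have tq: "t \<notin> set ?q" using t by (auto dest: in_set_takeD)
      have "Suc i < length ?q" "E t (?q ! Suc i)" using that L ti by auto
      then obtain j ws where j: "0 < j" "j \<le> Suc i" "E t (?q ! j)" "induced_cycle V E ws" "length ws = j - 0 + 2"
        using next_nbr_cycle[OF q qV tq, of 0 "Suc i"] tv by (metis nth_Cons_0 zero_less_Suc)
      then have "j \<noteq> 1" using t0 L by auto
      moreover have "length ws < length vs" using j i that L vp(1) by auto
      ultimately show False using less(1)[OF _ j(4)] j by auto
    qed
    obtain R' where R': "clique R'" "card R' = card K" "p ! L \<in> R'" "p ! (L - 1) \<in> R'"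
      using edge_in_max[of "p ! L" "p ! (L - 1)"] p_adj[of L "L - 1"] L by auto
    obtain w where w: "w \<in> R'" "w \<noteq> p ! L" "w \<noteq> p ! (L - 1)" using third[OF R'(2)] by blast
    have w_adj: "E w (p ! L)" "E w (p ! (L - 1))" using cliqueD[OF R'(1)] w R' by auto
    have wR: "w \<notin> R"
      using uniq[OF R(1,2) out[of "L - 1"] _ R(4), of w] w w_adj p_adj[of "L - 1" L] L edge_sym by auto
    \<comment> \<open>Fold the part of p away from p ! L onto the edge between w and p ! (L - 1), whose ends lie
      outside R and so have p ! L as only neighbour in R.\<close>
    define h where "h i = (if i = L then p ! L else if even (L - 1 - i) then p ! (L - 1) else w)" for i
    have h_step: "E (h i) (h (Suc i))" if "Suc i < length p" for i
    proof (cases "Suc i = L")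
      case True
      then show ?thesis using p_adj[of "L - 1" L] L by (auto simp: h_def)
    next
      case False
      then have "L - 1 - i = Suc (L - 1 - Suc i)" "Suc i < L" using that L by auto
      then show ?thesis using w_adj edge_sym by (auto simp: h_def)
    qed
    have hV: "h i \<in> V" for i using pV[of L] pV[of "L - 1"] edge_in[OF w_adj(1)] by (auto simp: h_def)
    \<comment> \<open>\<open>t\<close> joins the domain so that the image of \<open>v\<close> has
      two neighbours in \<open>R\<close>.\<close>
    define S where "S = insert t (set p)"
    define f where "f x = (if x = t then t else h (inv_into {..L} ((!) p) x))" for x
    have inj: "inj_on ((!) p) {..L}" using p_eq by (auto simp: inj_on_def)
    have f_p: "f (p ! i) = h i" if "i \<le> L" for i
      using t_p[OF that] that by (auto simp: f_def inv_into_f_f[OF inj])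
    have ft: "f t = t" by (simp add: f_def)
    have S_cases: "x = t \<or> (\<exists>i\<le>L. x = p ! i)" if "x \<in> S" for x
      using that L unfolding S_def insert_iff in_set_conv_nth by (metis less_Suc_eq_le)
    have t_nbr: "i = L" if "E t (p ! i)" "i \<le> L" for i using t_adj[of i] that by linarith
    have hL: "h L = p ! L" by (simp add: h_def)
    have SV: "S \<subseteq> V" using vp(3) R(1) t by (auto simp: S_def clique_def)
    have conn: "connected_on E S"
      unfolding S_def
      by (rule connected_on_insert[OF ipath_connected[OF vp(6)], of "p ! L"])
        (use L tv edge_sym in auto)
    have hom: "ghom S E V E f"
      unfolding ghom_def
    proof (intro conjI ballI impI)
      show "f x \<in> V" if "x \<in> S" for x using S_cases[OF that] f_p hV ft SV by (auto simp: S_def)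
      fix x y assume xy: "x \<in> S" "y \<in> S" "E x y"
      consider "x = t" "y = t" | i where "x = t" "y = p ! i" "i \<le> L" | i where "y = t" "x = p ! i" "i \<le> L"
        | i j where "x = p ! i" "i \<le> L" "y = p ! j" "j \<le> L"
        using S_cases xy by metis
      then show "E (f x) (f y)"
      proof cases
        case 1 then show ?thesis using xy by simp
      next
        case 2 then show ?thesis using xy t_nbr[of i] f_p[of i] ft tv hL by auto
      next
        case 3 then show ?thesis using xy t_nbr[of i] f_p[of i] ft tv hL edge_sym by auto
      next
        case 4
        then have "j = Suc i \<or> i = Suc j" using p_adj xy by blast
        then show ?thesis using 4 f_p h_step[of i] h_step[of j] L edge_sym by auto
      qed
    qed
    have "v \<notin> S" using vp(5) t by (auto simp: S_def)
    from one_point_extD[OF ext SV conn hom vp(2) this] obtain z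
      where z: "z \<in> V" "\<And>u. u \<in> S \<Longrightarrow> E u v \<Longrightarrow> E (f u) z" by metis
    have zt: "E t z" using z(2)[of t] tv ft by (simp add: S_def)
    have zL: "E (p ! L) z" using z(2)[of "p ! L"] f_p[of L] hL v_adj[of L] L edge_sym by (auto simp: S_def)
    have z0: "E (h 0) z" using z(2)[of "p ! 0"] f_p[of 0] v_adj[of 0] L edge_sym by (auto simp: S_def)
    \<comment> \<open>A vertex outside \<open>R\<close> has at most one neighbour in
      \<open>R\<close>, while \<open>z\<close> is adjacent to both \<open>t\<close> and
      \<open>p ! L\<close>.\<close>
    have zR: "z \<in> R"
      using uniq[OF R(1,2) _ t(1) R(4), of z] t zt zL edge_sym by blast
    have "h 0 \<notin> R" "E (h 0) (p ! L)"
      using L wR out[of "L - 1"] w_adj(1) p_adj[of "L - 1" L] by (auto simp: h_def)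
    then have "z = p ! L" using uniq[OF R(1,2) _ zR R(4), of "h 0"] z0 by blast
    then show False using zL by simp
  qed
qed

text \<open>The components are the largest cliques. Every clique extends to one of them, two of them
  meet in at most one vertex because an outside vertex has at most one neighbour in each, and
  induced cycles, being triangles, are cliques.\<close>

lemma max_clique_treelike:
  assumes ext: "one_point_ext V E" and K: "clique K" "3 \<le> card K"
    and max: "\<And>Q. clique Q \<Longrightarrow> card Q \<le> card K"
  shows "Kn_treelike (card K) V E"
proof -
  let ?C = "{C. clique C \<and> card C = card K}"
  have in_max: "\<exists>C\<in>?C. Q \<subseteq> C" if "clique Q" "Q \<noteq> {}" for Q
    using one_point_ext_clique_extend[OF ext K(1) that max[OF that(1)]] by blast
  show ?thesis
    unfolding Kn_treelike_def
  proof (intro conjI exI[of _ ?C] ballI allI impI)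
    show "\<Union>?C = V"
    proof
      show "V \<subseteq> \<Union>?C"
      proof
        fix x assume "x \<in> V"
        then have "clique {x}" by (auto simp: clique_def)
        then show "x \<in> \<Union>?C" using in_max[of "{x}"] by blast
      qed
    qed (auto simp: clique_def)
    show "\<exists>C\<in>?C. x \<in> C \<and> y \<in> C" if "E x y" for x y
    proof -
      have "clique {x, y}" using that edge_in edge_sym by (auto simp: clique_def)
      then show ?thesis using in_max[of "{x, y}"] by blast
    qed
    show "card (C \<inter> D) \<le> 1" if "C \<in> ?C" "D \<in> ?C" "C \<noteq> D" for C D
    proof -
      have C: "clique C" "card C = card K" and D: "clique D" "card D = card K" using that by auto
      have "\<not> D \<subseteq> C" using card_subset_eq[OF clique_finite[OF C(1)]] C D that(3) by auto
      then obtain d where d: "d \<in> D" "d \<notin> C" by blast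
      have "a = b" if "a \<in> C \<inter> D" "b \<in> C \<inter> D" for a b
        using max_clique_nbr_unique[OF ext C(1) _ d(2), of a b] max C(2) that d cliqueD[OF D(1) d(1)]
        by auto
      then show ?thesis by (simp add: card_le_Suc0_iff_eq clique_finite[OF C(1)])
    qed
    show "\<exists>C\<in>?C. set vs \<subseteq> C" if vs: "induced_cycle V E vs" for vs
    proof -
      have len: "length vs = 3" using max_clique_no_long_cycle[OF ext K max vs] .
      have "E (vs ! i) (vs ! j)" if "i < 3" "j < 3" "i \<noteq> j" for i j
      proof -
        have "j = Suc i mod 3 \<or> i = Suc j mod 3" 
        proof -
          have "i = 0 \<or> i = 1 \<or> i = 2" "j = 0 \<or> j = 1 \<or> j = 2" using that by auto
          then show ?thesis using that(3) by (elim disjE) simp_all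
        qed
        moreover have "E (vs ! i) (vs ! j) \<longleftrightarrow> j = Suc i mod 3 \<or> i = Suc j mod 3"
          using vs that len unfolding induced_cycle_def by simp
        ultimately show ?thesis by blast
      qed
      then have "E x y" if "x \<in> set vs" "y \<in> set vs" "x \<noteq> y" for x y
        using that by (metis in_set_conv_nth len)
      moreover have "set vs \<subseteq> V" using vs unfolding induced_cycle_def by (elim conjE)
      ultimately have "clique (set vs)"
        unfolding clique_def by blast
      moreover have "set vs \<noteq> {}" using len by auto
      ultimately show ?thesis by (rule in_max)
    qed
  qed (use finite connected in \<open>auto simp: clique_def\<close>)
qed

subsection \<open>Triangle-free graphs\<close>

text \<open>The path \<open>p\<close> left after deleting \<open>v\<close> has an even number of
  vertices, so folding it onto the edge from \<open>v\<close> to \<open>p ! 0\<close> sends its ends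
  to the two different ends of that edge. The image of \<open>v\<close> then completes a
  triangle.\<close>

lemma no_odd_cycle:
  assumes ext: "one_point_ext V E" and tri: "\<And>x y z. E x y \<Longrightarrow> E y z \<Longrightarrow> \<not> E x z"
    and vs: "induced_cycle V E vs"
  shows "even (length vs)"
proof (rule ccontr)
  assume odd: "odd (length vs)"
  obtain v p where vp: "vs = v # p" "v \<in> V" "set p \<subseteq> V" "2 \<le> length p" "v \<notin> set p" "ipath E p"
    "\<And>i. i < length p \<Longrightarrow> E v (p ! i) \<longleftrightarrow> i = 0 \<or> Suc i = length p"
    using induced_cycle_cases[OF vs] by metis
  have ne: "p \<noteq> []" using vp(4) by auto
  have ab: "E v (p ! 0)" using ne vp(7)[of 0] by auto
  define h where "h i = (if even i then v else p ! 0)" for i :: nat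
  have hV: "h i \<in> V" for i using ab edge_in by (auto simp: h_def)
  have h: "E (h i) (h (Suc i))" for i using ab edge_sym by (auto simp: h_def)
  obtain w where w: "w \<in> V" "\<And>i. i < length p \<Longrightarrow> E (p ! i) v \<Longrightarrow> E (h i) w"
    using ipath_ext[where h = h, OF ext vp(6,3) ne vp(2,5) hV h] by metis
  have "E v w" using w(2)[of 0] ab edge_sym ne by (auto simp: h_def)
  moreover have "E v (p ! (length p - 1))" using vp(4) vp(7)[of "length p - 1"] by auto
  then have "E (p ! 0) w"
    using w(2)[of "length p - 1"] odd vp(1) ne edge_commute[of _ v] by (simp add: h_def)
  ultimately show False using tri ab by blast
qed

text \<open>Deleting \<open>v\<close> leaves a path with an odd number of vertices, at least five.
  It is mapped along the walk and then back and forth between \<open>x4\<close> and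
  \<open>x3\<close>. By parity its last vertex goes to \<open>x4\<close>, so the image of
  \<open>v\<close> is adjacent to \<open>x0\<close> and \<open>x4\<close>.\<close>

lemma long_cycle_walk_common_nbr:
  assumes ext: "one_point_ext V E"
    and vs: "induced_cycle V E vs" "even (length vs)" "length vs \<noteq> 4"
    and x: "E x0 x1" "E x1 x2" "E x2 x3" "E x3 x4"
  shows "\<exists>w. E x0 w \<and> E x4 w"
proof -
  obtain v p where vp: "vs = v # p" "v \<in> V" "set p \<subseteq> V" "2 \<le> length p" "v \<notin> set p" "ipath E p"
    "\<And>i. i < length p \<Longrightarrow> E v (p ! i) \<longleftrightarrow> i = 0 \<or> Suc i = length p"
    using induced_cycle_cases[OF vs(1)] by metis
  have ne: "p \<noteq> []" using vp(4) by auto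
  have odd: "odd (length p)" and len: "5 \<le> length p"
  proof -
    show "odd (length p)" using vs(2) vp(1) by simp
    moreover have "length p \<noteq> 3" using vs(3) vp(1) by simp
    moreover have "length p \<noteq> 2" "length p \<noteq> 4" using \<open>odd (length p)\<close> by auto
    ultimately show "5 \<le> length p" using vp(4) by linarith
  qed
  define h where "h i = (if i = 0 then x0 else if i = 1 then x1 else if i = 2 then x2
    else if even i then x4 else x3)" for i :: nat
  have hV: "h i \<in> V" for i
    using edge_in[OF x(1)] edge_in[OF x(2)] edge_in[OF x(4)] by (simp add: h_def)
  have h: "E (h i) (h (Suc i))" for i
  proof -
    consider "i = 0" | "i = 1" | "i = 2" | "3 \<le> i" by linarith
    then show ?thesis
    proof cases
      case 4
      then show ?thesis using x edge_sym by (auto simp: h_def)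
    qed (use x in \<open>simp_all add: h_def\<close>)
  qed
  obtain w where w: "w \<in> V" "\<And>i. i < length p \<Longrightarrow> E (p ! i) v \<Longrightarrow> E (h i) w"
    using ipath_ext[where h = h, OF ext vp(6,3) ne vp(2,5) hV h] by metis
  have "E (p ! 0) v" using vp(7)[of 0] ne edge_sym by auto
  then have "E x0 w" using w(2)[of 0] ne by (auto simp: h_def)
  moreover have "E (p ! (length p - 1)) v" using vp(7)[of "length p - 1"] ne edge_sym by auto
  then have "E (h (length p - 1)) w" using w(2)[of "length p - 1"] ne by auto
  moreover have "h (length p - 1) = x4" using len odd by (auto simp: h_def)
  ultimately show ?thesis by auto
qed

text \<open>Without \<open>c\<close>, two squares become the induced path \<open>b\<close>,
  \<open>a\<close>, \<open>f\<close>, \<open>e\<close>, \<open>d\<close>, which is mapped along the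
  walk. As \<open>c\<close> is adjacent to both ends of the path, its image is the common
  neighbour.\<close>

lemma two_squares_walk_common_nbr:
  assumes ext: "one_point_ext V E" and dom: "embeds two_squares_V two_squares_E V E"
    and x: "E x0 x1" "E x1 x2" "E x2 x3" "E x3 x4"
  shows "\<exists>w. E x0 w \<and> E x4 w"
proof -
  obtain a b c d e f where D: "{a, b, c, d, e, f} \<subseteq> V" "distinct [a, b, c, d, e, f]"
    "E a b" "E b c" "E c d" "E d e" "E e f" "E f a" "E c f"
    "\<not> E a c" "\<not> E a d" "\<not> E a e" "\<not> E b d" "\<not> E b e" "\<not> E b f" "\<not> E c e" "\<not> E d f"
    using dom unfolding embeds_two_squares_iff by (elim exE conjE) (rule that)
  let ?p = "[b, a, f, e, d]"
  have sing: "ipath E [d]" by (simp add: ipath_def)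
  have p: "ipath E ?p"
    by (intro ipath_Cons sing) (use D(2-) edge_commute[of f e] edge_commute[of b a] edge_commute[of e d]
      edge_commute[of a f] edge_commute[of f d] in \<open>auto simp: less_Suc_eq\<close>)
  \<comment> \<open>Beyond index 4 the value \<open>x4\<close> is a default that stays in
    \<open>V\<close>.\<close>
  define h where "h i = (if i < 5 then [x0, x1, x2, x3, x4] ! i else x4)" for i :: nat
  have hV: "h i \<in> V" for i
    using edge_in[OF x(1)] edge_in[OF x(2)] edge_in[OF x(4)] edge_in[OF x(3)]
    by (auto simp: h_def less_Suc_eq numeral_eq_Suc)
  have h: "E (h i) (h (Suc i))" if "Suc i < length ?p" for i
    using that x by (auto simp: h_def less_Suc_eq numeral_eq_Suc)
  have c: "set ?p \<subseteq> V" "?p \<noteq> []" "c \<in> V" "c \<notin> set ?p" using D(1,2) by auto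
  obtain w where w: "w \<in> V" "\<And>i. i < length ?p \<Longrightarrow> E (?p ! i) c \<Longrightarrow> E (h i) w"
    using ipath_ext[where h = h, OF ext p c hV h] by metis
  have "E x0 w" using w(2)[of 0] D(4) by (simp add: h_def)
  moreover have "E x4 w" using w(2)[of 4] edge_sym[OF D(5)] by (simp add: h_def)
  ultimately show ?thesis by blast
qed

section \<open>Bipartition by the parity of walks\<close>

lemma even_walk_common_nbr:
  assumes walk: "\<And>x0 x1 x2 x3 x4. E x0 x1 \<Longrightarrow> E x1 x2 \<Longrightarrow> E x2 x3 \<Longrightarrow> E x3 x4 \<Longrightarrow> \<exists>w. E x0 w \<and> E x4 w"
    and V: "card V \<noteq> 1" "x \<in> V" and n: "even n" "(E ^^ n) x y"
  shows "\<exists>w. E x w \<and> E y w"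
proof -
  have "(E ^^ (2 * m)) x y \<Longrightarrow> \<exists>w. E x w \<and> E y w" for m y
  proof (induction m arbitrary: y)
    case 0
    then show ?case using nbr_exists[OF V] by auto
  next
    case (Suc m)
    then have "(E ^^ Suc (Suc (2 * m))) x y" by simp
    then obtain u t where "(E ^^ (2 * m)) x t" "E t u" "E u y"
      by (auto elim!: relpowp_Suc_E)
    moreover from Suc.IH[OF this(1)] obtain c where "E x c" "E t c" by blast
    \<comment> \<open>The common neighbour \<open>c\<close> shortens the walk from \<open>x\<close>
      to \<open>t\<close> to length two, so \<open>x\<close>, \<open>c\<close>, \<open>t\<close>,
      \<open>u\<close>, \<open>y\<close> is a 4-walk.\<close>
    ultimately show ?case using walk[of x c t u y] edge_sym by blast
  qed
  then show ?thesis using n by (auto elim!: evenE)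
qed

text \<open>Vertices are sorted by the parity of walks from a root. Two vertices of one part are
  joined by an even walk, hence have a common neighbour. If the parts overlapped, two adjacent
  vertices would have one too, giving a triangle.\<close>

lemma bipartition_exists:
  assumes tri: "\<And>x y z. E x y \<Longrightarrow> E y z \<Longrightarrow> \<not> E x z" and V: "card V \<noteq> 1"
    and walk: "\<And>x0 x1 x2 x3 x4. E x0 x1 \<Longrightarrow> E x1 x2 \<Longrightarrow> E x2 x3 \<Longrightarrow> E x3 x4 \<Longrightarrow> \<exists>w. E x0 w \<and> E x4 w"
  obtains X Y where "bipartition X Y"
    "\<forall>x\<in>X. \<forall>y\<in>X. \<exists>w. E x w \<and> E y w" "\<forall>x\<in>Y. \<forall>y\<in>Y. \<exists>w. E x w \<and> E y w"
proof -
  obtain r where r: "r \<in> V" using V_nonempty by blast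
  have common: "\<exists>w. E x w \<and> E y w" if "x \<in> V" "even n" "(E ^^ n) x y" for x y n
    by (rule even_walk_common_nbr[OF _ V that]) (rule walk)
  define X where "X = {x\<in>V. \<exists>n. even n \<and> (E ^^ n) r x}"
  define Y where "Y = {x\<in>V. \<exists>n. odd n \<and> (E ^^ n) r x}"
  have XY: "y \<in> Y" if xy: "x \<in> X" "E x y" for x y
  proof -
    obtain n where n: "even n" "(E ^^ n) r x" using xy(1) by (auto simp: X_def)
    then have "odd (Suc n)" "(E ^^ Suc n) r y" using relpowp_Suc_I[OF n(2) xy(2)] by simp_all
    then show ?thesis using edge_in(2)[OF xy(2)] unfolding Y_def by blast
  qed
  have YX: "y \<in> X" if xy: "x \<in> Y" "E x y" for x y
  proof -
    obtain n where n: "odd n" "(E ^^ n) r x" using xy(1) by (auto simp: Y_def)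
    then have "even (Suc n)" "(E ^^ Suc n) r y" using relpowp_Suc_I[OF n(2) xy(2)] by simp_all
    then show ?thesis using edge_in(2)[OF xy(2)] unfolding X_def by blast
  qed
  have "(E ^^ 0) r r" by simp
  then have "r \<in> X" using r even_zero unfolding X_def by blast
  have cover: "x \<in> X \<union> Y" if "x \<in> V" for x
    by (rule connected_on_induct[OF connected r, of "\<lambda>x. x \<in> X \<union> Y"])
      (use \<open>r \<in> X\<close> XY YX that in auto)
  \<comment> \<open>A return walk to \<open>r\<close> of known parity; followed by a walk from
    \<open>r\<close> to \<open>y\<close> it gives an even walk from \<open>x\<close> to
    \<open>y\<close>.\<close>
  have back_X: "(E ^^ 2) x r" if x: "x \<in> X" for x
  proof -
    obtain n where "even n" "(E ^^ n) r x" using x by (auto simp: X_def)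
    then obtain c where "E r c" "E x c" using common[OF r] by blast
    then show ?thesis using edge_sym[of r c] by (auto simp: numeral_2_eq_2)
  qed
  have back_Y: "(E ^^ 3) x r" if x: "x \<in> Y" for x
  proof -
    obtain n where n: "odd n" "(E ^^ n) r x" using x by (auto simp: Y_def)
    then obtain m where m: "n = Suc m" "even m" by (cases n) auto
    then obtain u where u: "(E ^^ m) r u" "E u x" using n by (auto elim: relpowp_Suc_E)
    then have "u \<in> X" using m edge_in by (auto simp: X_def)
    from relpowp_Suc_I2[of E, OF edge_sym[OF u(2)] back_X[OF this]] show ?thesis
      by (simp only: Suc_numeral semiring_norm)
  qed
  have X: "\<exists>w. E x w \<and> E y w" if xy: "x \<in> X" "y \<in> X" for x y
  proof -
    obtain n where n: "even n" "(E ^^ n) r y" using xy(2) unfolding X_def by blast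
    have "x \<in> V" using xy(1) by (simp add: X_def)
    moreover have "even (2 + n)" using n(1) by simp
    ultimately show ?thesis
      using relpowp_trans[OF back_X[OF xy(1)] n(2)] by (rule common)
  qed
  have Y: "\<exists>w. E x w \<and> E y w" if xy: "x \<in> Y" "y \<in> Y" for x y
  proof -
    obtain n where n: "odd n" "(E ^^ n) r y" using xy(2) unfolding Y_def by blast
    have "x \<in> V" using xy(1) by (simp add: Y_def)
    moreover have "even (3 + n)" using n(1) by simp
    ultimately show ?thesis
      using relpowp_trans[OF back_Y[OF xy(1)] n(2)] by (rule common)
  qed
  have disj: "X \<inter> Y = {}"
  proof (rule ccontr)
    assume "X \<inter> Y \<noteq> {}"
    then obtain x where x: "x \<in> X" "x \<in> Y" by blast
    then have "x \<in> V" by (simp add: X_def)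
    then obtain y where y: "E x y" using nbr_exists[OF V] by metis
    then have "y \<in> Y" using XY x by blast
    then obtain w where "E x w" "E y w" using Y x by blast
    then show False using tri[of x y w] y by blast
  qed
  have "bipartition X Y"
    unfolding bipartition_def
  proof (intro conjI allI impI disj)
    show "X \<union> Y = V" using cover by (auto simp: X_def Y_def)
    fix x y assume xy: "E x y"
    then show "x \<in> X \<and> y \<in> Y \<or> x \<in> Y \<and> y \<in> X"
      using cover[OF edge_in(1)[OF xy]] XY YX by blast
  qed
  then show ?thesis using that X Y by blast
qed

section \<open>Crowns: bipartite complements of perfect matchings\<close>

text \<open>S together with t ` S induces the bipartite complement of the perfect matching between x and t x.\<close>
definition crown :: "'a set \<Rightarrow> ('a \<Rightarrow> 'a) \<Rightarrow> bool" where
  "crown S t \<longleftrightarrow> 3 \<le> card S \<and> (\<forall>x\<in>S. \<forall>y\<in>S. E x (t y) \<longleftrightarrow> x \<noteq> y)"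

lemma crown_edge: "crown S t \<Longrightarrow> x \<in> S \<Longrightarrow> y \<in> S \<Longrightarrow> E x (t y) \<longleftrightarrow> x \<noteq> y"
  by (simp add: crown_def)

lemma crown_edge': "crown S t \<Longrightarrow> x \<in> S \<Longrightarrow> y \<in> S \<Longrightarrow> E (t y) x \<longleftrightarrow> x \<noteq> y"
  by (simp add: crown_def edge_commute[of "t y"])

lemma crown_inj: "crown S t \<Longrightarrow> inj_on t S"
  unfolding crown_def by (metis inj_onI)

lemma crown_third:
  assumes "crown S t"
  obtains z where "z \<in> S" "z \<noteq> x" "z \<noteq> y"
  using third_element assms unfolding crown_def by metis

text \<open>The two sides of a crown are interchangeable, so that results stated for
  \<open>S\<close> also apply to the other side.\<close>

lemma crown_swap:
  assumes "crown S t"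
  shows "crown (t ` S) (inv_into S t)" "inv_into S t ` t ` S = S"
proof -
  note inj = crown_inj[OF assms]
  show "crown (t ` S) (inv_into S t)"
    using assms crown_edge'[OF assms] inj_on_eq_iff[OF inj] card_image[OF inj]
    by (auto simp: crown_def inv_into_f_f[OF inj])
  show "inv_into S t ` t ` S = S" using inj by (simp add: image_inv_into_cancel inv_into_image_cancel)
qed

text \<open>From \<open>r\<close> one reaches every \<open>t x\<close> with \<open>x\<close> other
  than \<open>r\<close>, from these all of \<open>S\<close>, and finally \<open>t r\<close>. The
  second step is where a third index is needed.\<close>

lemma crown_connected:
  assumes cr: "crown S t"
  shows "connected_on E (S \<union> t ` S)"
proof -
  obtain r where r: "r \<in> S" using crown_third[OF cr] by metis
  show ?thesis
  proof (rule connected_onI[OF edge_sym])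
    show "r \<in> S \<union> t ` S" using r by simp
    fix U assume U: "r \<in> U" "\<And>x y. x \<in> U \<Longrightarrow> x \<in> S \<union> t ` S \<Longrightarrow> y \<in> S \<union> t ` S \<Longrightarrow> E x y \<Longrightarrow> y \<in> U"
    have t: "t x \<in> U" if "x \<in> S" "x \<noteq> r" for x
      using U(2)[of r "t x"] U(1) r that crown_edge[OF cr, of r x] by auto
    have S: "x \<in> U" if "x \<in> S" for x
    proof -
      obtain z where "z \<in> S" "z \<noteq> r" "z \<noteq> x" using crown_third[OF cr] by metis
      then show ?thesis using U(2)[of "t z" x] t that crown_edge'[OF cr, of x z] by auto
    qed
    obtain z where "z \<in> S" "z \<noteq> r" using crown_third[OF cr] by metis
    then have "t r \<in> U" using U(2)[of z "t r"] S r crown_edge[OF cr, of z r] by auto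
    then show "S \<union> t ` S \<subseteq> U" using S t by auto
  qed
qed

lemma crown_other_side:
  assumes "bipartition X Y" "S \<subseteq> X" "crown S t"
  shows "t ` S \<subseteq> Y"
proof
  fix y assume "y \<in> t ` S"
  then obtain x where x: "x \<in> S" "y = t x" by blast
  obtain z where "z \<in> S" "z \<noteq> x" using crown_third[OF assms(3)] by metis
  then have "E z y" "z \<in> X" using x crown_edge[OF assms(3)] assms(2) by auto
  then show "y \<in> Y" using assms(1) unfolding bipartition_def by blast
qed

text \<open>A common neighbour of t ` S would be carried by the swap of S and t ` S to one of S.\<close>
lemma crown_no_common_nbr:
  assumes ext: "one_point_ext V E" and bip: "bipartition X Y" and S: "S \<subseteq> X" and cr: "crown S t"
    and no: "\<not> (\<exists>a. \<forall>x\<in>S. E a x)"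
  shows "\<not> (\<exists>a. \<forall>x\<in>t ` S. E a x)"
proof
  assume "\<exists>a. \<forall>x\<in>t ` S. E a x"
  then obtain v where v: "\<And>x. x \<in> S \<Longrightarrow> E v (t x)" by blast
  have TY: "t ` S \<subseteq> Y" by (rule crown_other_side[OF bip S cr])
  note inj = crown_inj[OF cr]
  have disj: "X \<inter> Y = {}" and indep: "\<And>x y. E x y \<Longrightarrow> x \<in> X \<longleftrightarrow> y \<in> Y" "X \<union> Y = V"
    using bip unfolding bipartition_def by blast+
  obtain r where r: "r \<in> S" using crown_third[OF cr] by metis
  have "v \<in> X" using indep(1)[OF v[OF r]] TY r by blast
  have vS: "v \<notin> S" using v crown_edge[OF cr, of v v] by auto
  have vT: "v \<notin> t ` S" using \<open>v \<in> X\<close> TY disj by blast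
  define f where "f x = (if x \<in> S then t x else inv_into S t x)" for x
  have fS: "f x = t x" if "x \<in> S" for x using that by (simp add: f_def)
  have fT: "f (t x) = x" if "x \<in> S" for x
  proof -
    have "t x \<notin> S" using that TY S disj by blast
    then show ?thesis using that by (simp add: f_def inv_into_f_f[OF inj])
  qed
  have SV: "S \<union> t ` S \<subseteq> V" using S TY indep(2) by blast
  have hom: "ghom (S \<union> t ` S) E V E f"
    unfolding ghom_def
  proof (intro conjI ballI impI)
    show "f x \<in> V" if "x \<in> S \<union> t ` S" for x using that SV fS fT by auto
    fix x y assume xy: "x \<in> S \<union> t ` S" "y \<in> S \<union> t ` S" "E x y"
    have "\<not> (x \<in> S \<and> y \<in> S)" "\<not> (x \<in> t ` S \<and> y \<in> t ` S)"
      using indep(1)[OF xy(3)] S TY disj by blast+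
    then consider a b where "x = a" "y = t b" "a \<in> S" "b \<in> S" | a b where "x = t a" "y = b" "a \<in> S" "b \<in> S"
      using xy by blast
    then show "E (f x) (f y)"
    proof cases
      case 1
      then show ?thesis using xy(3) by (simp add: fS fT crown_edge[OF cr] crown_edge'[OF cr])
    next
      case 2
      then show ?thesis using xy(3) by (simp add: fS fT crown_edge[OF cr] crown_edge'[OF cr])
    qed
  qed
  have "v \<in> V" "v \<notin> S \<union> t ` S" using \<open>v \<in> X\<close> indep(2) vS vT by blast+
  from one_point_extD[OF ext SV crown_connected[OF cr] hom this] obtain w
    where w: "w \<in> V" "\<And>u. u \<in> S \<union> t ` S \<Longrightarrow> E u v \<Longrightarrow> E (f u) w" by metis
  have "E w x" if "x \<in> S" for x
    using w(2)[of "t x"] v[OF that] fT[OF that] that edge_sym by auto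
  then show False using no by blast
qed

text \<open>Delete a neighbour s of z from the crown, link z to t s by a vertex w, and send z to t s:
  the image of the neighbourhood of s is then all of t ` S.\<close>
lemma crown_no_outer_nbr:
  assumes ext: "one_point_ext V E" and bip: "bipartition X Y" and S: "S \<subseteq> X" and cr: "crown S t"
    and no: "\<not> (\<exists>a. \<forall>x\<in>t ` S. E a x)"
    and pairs: "\<And>x y. x \<in> Y \<Longrightarrow> y \<in> Y \<Longrightarrow> \<exists>w. E x w \<and> E y w"
    and z: "z \<in> Y" "z \<notin> t ` S" and s: "s \<in> S"
  shows "\<not> E z s"
proof
  assume zs: "E z s"
  have TY: "t ` S \<subseteq> Y" by (rule crown_other_side[OF bip S cr])
  have disj: "X \<inter> Y = {}" and side: "\<And>x y. E x y \<Longrightarrow> x \<in> X \<longleftrightarrow> y \<in> Y" and XYV: "X \<union> Y = V"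
    using bip unfolding bipartition_def by blast+
  obtain w where w: "E z w" "E (t s) w" using pairs[of z "t s"] z TY s by blast
  have wX: "w \<in> X" using side[OF edge_sym[OF w(1)]] z by blast
  have ws: "w \<noteq> s" using w(2) crown_edge'[OF cr s s] by auto
  \<comment> \<open>\<open>w\<close> will be sent to \<open>i\<close>: a neighbour
    \<open>t j\<close> of \<open>w\<close> has \<open>j\<close> different from \<open>i\<close>, so
    the edge survives. If \<open>w\<close> lies in \<open>S\<close>, it is already equal to
    \<open>i\<close>, and \<open>f\<close> fixes \<open>S\<close>.\<close>
  obtain i where i: "i \<in> S" "\<not> E w (t i)" using no by blast
  have ine: "i \<noteq> s" using i w(2) edge_sym by blast
  have wi: "w = i" if "w \<in> S" using i crown_edge[OF cr that i(1)] by blast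
  define H where "H = insert z (insert w ((S - {s}) \<union> t ` S))"
  define f where "f x = (if x = z then t s else if x = w then i else x)" for x
  have zX: "z \<notin> X" and zS: "z \<notin> S" and wT: "w \<notin> t ` S" and zw: "z \<noteq> w"
    using z wX S TY disj by blast+
  have fz: "f z = t s" and fw: "f w = i" by (auto simp: f_def zw[symmetric])
  have fS: "f x = x" if "x \<in> S" for x using that zS wi by (auto simp: f_def)
  have fT: "f (t x) = t x" if "x \<in> S" for x
  proof -
    have "t x \<noteq> z" "t x \<noteq> w" using that z wT by auto
    then show ?thesis by (simp add: f_def)
  qed
  have HV: "H \<subseteq> V" using S TY z wX XYV by (auto simp: H_def)
  have conn: "connected_on E H"
  proof (rule connected_onI[OF edge_sym])
    show "t s \<in> H" using s by (simp add: H_def)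
    fix U assume U: "t s \<in> U" "\<And>x y. x \<in> U \<Longrightarrow> x \<in> H \<Longrightarrow> y \<in> H \<Longrightarrow> E x y \<Longrightarrow> y \<in> U"
    have US: "x \<in> U" if "x \<in> S" "x \<noteq> s" for x
      using U(2)[of "t s" x] U(1) that s crown_edge'[OF cr, of x s] by (simp add: H_def)
    have UT: "t x \<in> U" if "x \<in> S" for x
    proof -
      obtain y where "y \<in> S" "y \<noteq> s" "y \<noteq> x" using crown_third[OF cr] by metis
      then show ?thesis using U(2)[of y "t x"] US that crown_edge[OF cr, of y x] by (simp add: H_def)
    qed
    have "w \<in> U" using U(2)[of "t s" w] U(1) w s by (simp add: H_def)
    moreover from this have "z \<in> U" using U(2)[of w z] edge_sym[OF w(1)] by (simp add: H_def)
    ultimately show "H \<subseteq> U" using US UT by (auto simp: H_def)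
  qed
  have cross: "E (f x) (f y)" if xy: "x \<in> H" "y \<in> H" "x \<in> X" "y \<in> Y" "E x y" for x y
  proof -
    have x: "x = w \<or> x \<in> S - {s}" using xy(1,3) zX TY disj by (auto simp: H_def)
    have y: "y = z \<or> y \<in> t ` S" using xy(2,4) wX S disj by (auto simp: H_def)
    from y show ?thesis
    proof
      assume yz: "y = z"
      have "f x \<in> S - {s}" using x fw fS i ine by auto
      then show ?thesis using crown_edge[OF cr, of "f x" s] s yz fz by simp
    next
      assume "y \<in> t ` S"
      then obtain j where j: "j \<in> S" "y = t j" by blast
      from x show ?thesis
      proof
        assume "x = w"
        then have "j \<noteq> i" using xy(5) j i by auto
        then show ?thesis using \<open>x = w\<close> fw fT[OF j(1)] j crown_edge[OF cr i(1) j(1)] by simp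
      next
        assume "x \<in> S - {s}"
        then show ?thesis using fS[of x] fT[OF j(1)] j(2) xy(5) by simp
      qed
    qed
  qed
  have hom: "ghom H E V E f"
    unfolding ghom_def
  proof (intro conjI ballI impI)
    show "f x \<in> V" if "x \<in> H" for x
      using that fz fw fS fT HV s i S TY XYV by (auto simp: H_def)
    fix x y assume xy: "x \<in> H" "y \<in> H" "E x y"
    then consider "x \<in> X" "y \<in> Y" | "x \<in> Y" "y \<in> X" using bip unfolding bipartition_def by blast
    then show "E (f x) (f y)"
      by cases (use cross[of x y] cross[of y x] xy edge_sym in blast)+
  qed
  have "s \<in> V" "s \<notin> H" using s S TY XYV zS ws disj by (auto simp: H_def)
  from one_point_extD[OF ext HV conn hom this] obtain v
    where v: "v \<in> V" "\<And>u. u \<in> H \<Longrightarrow> E u s \<Longrightarrow> E (f u) v" by metis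
  have "E v (t x)" if "x \<in> S" for x
  proof (cases "x = s")
    case True
    then show ?thesis using v(2)[of z] zs fz edge_sym by (simp add: H_def)
  next
    case False
    then show ?thesis
      using v(2)[of "t x"] that fT[OF that] crown_edge'[OF cr s that] edge_sym by (simp add: H_def)
  qed
  then show False using no by blast
qed

text \<open>\<open>S\<close> is a set of least size without a common neighbour. So each
  \<open>S - {x}\<close> has a common neighbour \<open>t x\<close>, which cannot be adjacent to
  \<open>x\<close>. Since pairs have common neighbours, \<open>S\<close> has at least three
  elements.\<close>

lemma crown_exists:
  assumes bip: "bipartition X Y"
    and pairs: "\<And>x y. x \<in> X \<Longrightarrow> y \<in> X \<Longrightarrow> \<exists>w. E x w \<and> E y w"
    and no: "\<not> (\<exists>a\<in>V. \<forall>x\<in>X. E a x)"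
  obtains S t where "S \<subseteq> X" "crown S t" "\<not> (\<exists>a. \<forall>x\<in>S. E a x)"
proof -
  let ?P = "\<lambda>S. S \<subseteq> X \<and> \<not> (\<exists>a\<in>V. \<forall>x\<in>S. E a x)"
  have "?P X" using no by simp
  from ex_has_least_nat[of ?P X card, OF this]
  obtain S where S: "?P S" "\<And>T. ?P T \<Longrightarrow> card S \<le> card T" by metis
  have "X \<subseteq> V" using bip by (auto simp: bipartition_def)
  then have "S \<subseteq> V" using S(1) by (meson subset_trans)
  then have fin: "finite S" using finite by (rule finite_subset)
  have "\<exists>a. \<forall>y\<in>S - {x}. E a y" if "x \<in> S" for x
  proof -
    have "card (S - {x}) < card S" using that fin by (rule card_Diff1_less[rotated])
    then have *: "\<not> ?P (S - {x})" using S(2)[of "S - {x}"] by linarith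
    have "S - {x} \<subseteq> X" using S(1) by blast
    then have "\<exists>a\<in>V. \<forall>y\<in>S - {x}. E a y" using * by simp
    then show ?thesis by (elim bexE) (rule exI)
  qed
  then obtain t where t: "\<And>x y. x \<in> S \<Longrightarrow> y \<in> S - {x} \<Longrightarrow> E (t x) y" by metis
  \<comment> \<open>A vertex with a neighbour lies in \<open>V\<close>. An empty \<open>S\<close> is
    ruled out because any vertex of \<open>V\<close> would be a common neighbour of it.\<close>
  have no': "\<not> (\<exists>a. \<forall>x\<in>S. E a x)"
  proof
    assume "\<exists>a. \<forall>x\<in>S. E a x"
    then obtain a where a: "\<forall>x\<in>S. E a x" by blast
    show False
    proof (cases "S = {}")
      case True then show ?thesis using S(1) V_nonempty by blast
    next
      case False then show ?thesis using S(1) a edge_in by blast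
    qed
  qed
  obtain x where x: "x \<in> S" using no' by blast
  have pair: "\<not> S \<subseteq> {x, y}" if "y \<in> S" for y
  proof
    assume sub: "S \<subseteq> {x, y}"
    have "x \<in> X" "y \<in> X" using x that S(1) by auto
    then obtain w where "E x w" "E y w" using pairs by blast
    then have "\<forall>u\<in>S. E w u" using sub edge_sym by blast
    then show False using no' by blast
  qed
  obtain y where y: "y \<in> S" "y \<noteq> x" using pair[OF x] by blast
  obtain z where z: "z \<in> S" "z \<noteq> x" "z \<noteq> y" using pair[OF y(1)] by blast
  have "card {x, y, z} \<le> card S" using x y z fin by (intro card_mono) auto
  then have "3 \<le> card S" using y z by (auto simp: card_insert_if)
  moreover have "E u (t v) \<longleftrightarrow> u \<noteq> v" if "u \<in> S" "v \<in> S" for u v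
  proof
    show "u \<noteq> v" if "E u (t v)"
    proof
      assume "u = v"
      then have "\<forall>y\<in>S. E (t v) y" using t[of v] \<open>v \<in> S\<close> edge_sym[OF that] by blast
      then show False using no' by blast
    qed
    show "E u (t v)" if "u \<noteq> v" using t[of v u] \<open>u \<in> S\<close> \<open>v \<in> S\<close> that edge_sym by blast
  qed
  ultimately have "crown S t" by (simp add: crown_def)
  then show ?thesis using that S(1) no' by blast
qed

text \<open>The crown exhausts \<open>V\<close>: otherwise connectedness gives an edge leaving it.
  Such an edge is excluded at \<open>S\<close> directly, and at the other side by the same result
  for the swapped crown.\<close>

lemma bcpm_if_no_common_nbr:
  assumes ext: "one_point_ext V E" and bip: "bipartition X Y"
    and pX: "\<And>x y. x \<in> X \<Longrightarrow> y \<in> X \<Longrightarrow> \<exists>w. E x w \<and> E y w"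
    and pY: "\<And>x y. x \<in> Y \<Longrightarrow> y \<in> Y \<Longrightarrow> \<exists>w. E x w \<and> E y w"
    and no: "\<not> (\<exists>a\<in>V. \<forall>x\<in>X. E a x)"
  shows "\<exists>n\<ge>3. isomorphic (bcpm_V n) (bcpm_E n) V E"
proof -
  obtain S t where S: "S \<subseteq> X" and cr: "crown S t" and noS: "\<not> (\<exists>a. \<forall>x\<in>S. E a x)"
    using crown_exists[OF bip pX no] by metis
  have noT: "\<not> (\<exists>a. \<forall>x\<in>t ` S. E a x)" by (rule crown_no_common_nbr[OF ext bip S cr noS])
  have TY: "t ` S \<subseteq> Y" by (rule crown_other_side[OF bip S cr])
  have disj: "X \<inter> Y = {}" and side: "\<And>x y. E x y \<Longrightarrow> x \<in> X \<longleftrightarrow> y \<in> Y" and XYV: "X \<union> Y = V"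
    using bip unfolding bipartition_def by blast+
  have V: "S \<union> t ` S = V"
  proof (rule ccontr)
    assume ne: "S \<union> t ` S \<noteq> V"
    have "S \<union> t ` S \<subseteq> V" "S \<union> t ` S \<noteq> {}" using S TY XYV noS by blast+
    from connected_on_boundary[OF connected this ne] obtain u v
      where uv: "u \<in> S \<union> t ` S" "v \<in> V" "v \<notin> S \<union> t ` S" "E u v" by metis
    show False
    proof (cases "u \<in> S")
      case True
      then have "v \<in> Y" using side[OF uv(4)] S by blast
      then show False
        using crown_no_outer_nbr[OF ext bip S cr noT pY _ _ True, of v] uv edge_sym by blast
    next
      case False
      then have u: "u \<in> t ` S" using uv by blast
      have "v \<in> X" using side[OF edge_sym[OF uv(4)]] TY u by blast
      then show False
        using crown_no_outer_nbr[OF ext bipartition_commute[OF bip] TY crown_swap(1)[OF cr] _ pX _ _ u, of v]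
          uv edge_sym noS unfolding crown_swap(2)[OF cr] by blast
    qed
  qed
  note inj = crown_inj[OF cr]
  have "finite S" using finite V by (metis finite_Un)
  then obtain h where h: "bij_betw h {..<card S} S"
    using ex_bij_betw_nat_finite by (auto simp: atLeast0LessThan)
  let ?n = "card S"
  \<comment> \<open>With \<open>S\<close> numbered by \<open>h\<close>, index \<open>i\<close> names
    \<open>h i\<close> on one side and its non-neighbour \<open>t (h i)\<close> on the
    other.\<close>
  let ?F = "\<lambda>(b, i). if b then t (h i) else h i"
  have hS: "h i \<in> S" if "i < ?n" for i using bij_betw_apply[OF h] that by auto
  have h_eq: "h i = h j \<longleftrightarrow> i = j" if "i < ?n" "j < ?n" for i j
    using inj_on_eq_iff[OF bij_betw_imp_inj_on[OF h]] that by auto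
  have th_eq: "t (h i) = t (h j) \<longleftrightarrow> i = j" if "i < ?n" "j < ?n" for i j
    using inj_on_eq_iff[OF inj hS hS] h_eq that by auto
  have hne: "h i \<noteq> t (h j)" if "i < ?n" "j < ?n" for i j
    using hS[OF that(1)] hS[OF that(2)] S TY disj by blast
  have "bij_betw ?F (bcpm_V ?n) V"
    unfolding bij_betw_def
  proof
    show "inj_on ?F (bcpm_V ?n)"
      by (auto simp: inj_on_def bcpm_V_def h_eq th_eq hne hne[symmetric] split: if_splits)
    have "h ` {..<?n} = S" using h by (simp add: bij_betw_def)
    moreover have "?F ` bcpm_V ?n = h ` {..<?n} \<union> t ` h ` {..<?n}"
      by (force simp: bcpm_V_def image_iff)
    ultimately show "?F ` bcpm_V ?n = V" using V by simp
  qed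
  moreover have "bcpm_E ?n x y \<longleftrightarrow> E (?F x) (?F y)" if xy: "x \<in> bcpm_V ?n" "y \<in> bcpm_V ?n" for x y
  proof -
    obtain b i c j where ij: "x = (b, i)" "y = (c, j)" "i < ?n" "j < ?n"
      using xy by (cases x; cases y) (auto simp: bcpm_V_def)
    have "\<not> E (h i) (h j)" using side[of "h i" "h j"] hS ij S disj by blast
    moreover have "\<not> E (t (h i)) (t (h j))" using side[of "t (h i)" "t (h j)"] hS ij TY disj by blast
    ultimately show ?thesis
      using ij hS crown_edge[OF cr] crown_edge'[OF cr] h_eq by (auto simp: bcpm_E_def)
  qed
  ultimately have "isomorphic (bcpm_V ?n) (bcpm_E ?n) V E"
    unfolding isomorphic_def by blast
  then show ?thesis using cr unfolding crown_def by blast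
qed

section \<open>Assembling the triangle-free case and the triangle case\<close>

lemma triangle_free_classification:
  assumes ext: "one_point_ext V E" and tri: "\<And>x y z. E x y \<Longrightarrow> E y z \<Longrightarrow> \<not> E x z" and V: "card V \<noteq> 1"
    and not_sq: "\<not> ((\<forall>vs. induced_cycle V E vs \<longrightarrow> length vs = 4) \<and> \<not> embeds two_squares_V two_squares_E V E)"
  shows "bip_common_nbrs V E \<or> (\<exists>n\<ge>3. isomorphic (bcpm_V n) (bcpm_E n) V E)"
proof -
  \<comment> \<open>Failure of the square condition supplies two squares or an induced cycle of
    length other than 4, which is even in the absence of triangles. Either one gives the ends of
    every 4-walk a common neighbour.\<close>
  have walk: "\<exists>w. E x0 w \<and> E x4 w" if x: "E x0 x1" "E x1 x2" "E x2 x3" "E x3 x4" for x0 x1 x2 x3 x4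
  proof (cases "embeds two_squares_V two_squares_E V E")
    case True
    then show ?thesis by (rule two_squares_walk_common_nbr[OF ext _ x])
  next
    case False
    then obtain vs where vs: "induced_cycle V E vs" "length vs \<noteq> 4" using not_sq by blast
    show ?thesis
      by (rule long_cycle_walk_common_nbr[OF ext vs(1) no_odd_cycle[OF ext tri vs(1)] vs(2) x])
  qed
  obtain X Y where bip: "bipartition X Y"
    and pairs: "\<forall>x\<in>X. \<forall>y\<in>X. \<exists>w. E x w \<and> E y w" "\<forall>x\<in>Y. \<forall>y\<in>Y. \<exists>w. E x w \<and> E y w"
    by (rule bipartition_exists[OF tri V walk])
  note pX = pairs(1)[rule_format] and pY = pairs(2)[rule_format]
  show ?thesis
  proof (cases "(\<exists>a\<in>V. \<forall>x\<in>X. E a x) \<and> (\<exists>b\<in>V. \<forall>y\<in>Y. E b y)")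
    case True
    then have "bip_common_nbrs V E"
      using bip unfolding bip_common_nbrs_def bipartition_def by (intro exI[of _ X] exI[of _ Y]) simp
    then show ?thesis ..
  next
    case False
    then show ?thesis
      using bcpm_if_no_common_nbr[OF ext bip pX pY]
        bcpm_if_no_common_nbr[OF ext bipartition_commute[OF bip] pY pX] by blast
  qed
qed

lemma triangle_treelike:
  assumes ext: "one_point_ext V E" and tri: "E x y" "E y z" "E x z"
  shows "\<exists>n\<ge>2. Kn_treelike n V E"
proof -
  have cl: "clique {x, y, z}" using tri edge_in edge_sym unfolding clique_def by blast
  have "x \<noteq> y" "y \<noteq> z" "x \<noteq> z" using tri by (metis edge_irrefl)+
  then have card: "card {x, y, z} = 3" by simp
  have "\<forall>Q. clique Q \<longrightarrow> card Q < Suc (card V)"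
    using finite by (auto simp: clique_def card_mono less_Suc_eq_le)
  from ex_has_greatest_nat[of clique, OF cl this]
  obtain K where K: "clique K" "\<And>Q. clique Q \<Longrightarrow> card Q \<le> card K" by metis
  then have "3 \<le> card K" using card cl by metis
  then show ?thesis using max_clique_treelike[OF ext K(1) _ K(2)] by (intro exI[of _ "card K"]) auto
qed

text \<open>A connected set is nonempty, so here it is all of \<open>V\<close> and no vertex is left
  to extend to.\<close>

lemma one_point_ext_singleton:
  assumes "card V = 1"
  shows "one_point_ext V E"
  using assms by (auto simp: one_point_ext_def card_1_singleton_iff connected_on_def subset_singleton_iff)

end

theorem theorem1p2:
  fixes V :: "'a set" and E :: "'a \<Rightarrow> 'a \<Rightarrow> bool"
  assumes "sgraph V E" and "finite V" and "connected_on E V"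
  shows "C_HH V E \<longleftrightarrow>
     card V = 1
   \<or> (\<exists>n\<ge>2. Kn_treelike n V E)
   \<or> ((\<forall>vs. induced_cycle V E vs \<longrightarrow> length vs = 4) \<and> \<not> embeds two_squares_V two_squares_E V E)
   \<or> bip_common_nbrs V E
   \<or> (\<exists>n\<ge>3. isomorphic (bcpm_V n) (bcpm_E n) V E)"
proof -
  interpret finite_connected_graph V E
    using assms by unfold_locales
  show ?thesis
    unfolding C_HH_iff_one_point_ext
  proof
    assume ext: "one_point_ext V E"
    show "card V = 1 \<or> (\<exists>n\<ge>2. Kn_treelike n V E)
     \<or> ((\<forall>vs. induced_cycle V E vs \<longrightarrow> length vs = 4) \<and> \<not> embeds two_squares_V two_squares_E V E)
     \<or> bip_common_nbrs V E \<or> (\<exists>n\<ge>3. isomorphic (bcpm_V n) (bcpm_E n) V E)"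
    \<comment> \<open>A triangle leads to the treelike alternative. Trees belong to the other case:
      having no induced cycles, they satisfy the third alternative.\<close>
    proof (cases "\<exists>x y z. E x y \<and> E y z \<and> E x z")
      case True
      then show ?thesis using triangle_treelike[OF ext] by blast
    next
      case False
      then have tri: "\<not> E x z" if "E x y" "E y z" for x y z using that by blast
      show ?thesis
      proof (rule ccontr)
        assume not: "\<not> ?thesis"
        then have "card V \<noteq> 1"
          "\<not> ((\<forall>vs. induced_cycle V E vs \<longrightarrow> length vs = 4) \<and> \<not> embeds two_squares_V two_squares_E V E)"
          by simp_all
        from triangle_free_classification[OF ext tri this] not show False by simp
      qed
    qed
  qed (use one_point_ext_singleton one_point_ext_treelike one_point_ext_square_graph
      one_point_ext_bip_common_nbrs one_point_ext_bcpm in blast)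
qed

end
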